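(* Let $A$ be a finite-dimensional simple Jordan algebra with unit over $\mathbb C$ and let $l\ge1$. Up to equivalence there are only finitely many finite-dimensional irreducible generalized representations of $A$ of order $l$. In particular, $A$ has only finitely many inequivalent irreducible usual representations (order $l=2$) and only finitely many inequivalent irreducible Jacobson representations (order $l=3$).
   Context: Jordan algebra: commutative algebra satisfying $(x^2y)x=x^2(yx)$, product written $x*y$ or $xy$. $L(A)=U_{-1}\oplus U_0\oplus U_1$: $U_{-1}$ = space of $A$, $U_0=\mathrm{span}\{L_a,[L_a,L_b]\}$ with $L_a(x)=a*x$, $U_1=\mathrm{span}\{\bar A,A_a\}$ with $\bar A(x,y)=x*y$, $A_a(x,y)=(x*a)*y+(y*a)*x-a*(x*y)$; skew bracket $[U_{-1},U_{-1}]=0=[U_1,U_1]$, $[S,a]=S(a)$, $[S_1,S_2]=S_1S_2-S_2S_1$, $[B,a]=(y\mapsto B(a,y))$, $[S,B]=((x,y)\mapsto S(B(x,y))-B(Sx,y)-B(x,Sy))$. Generalized representation of $A$ (unit $e$) on $V$: pair $(\pi,a)$, $a\in\mathrm{End}\,V$, $\pi:A\to\mathrm{End}\,V$ linear with $\pi(x*y)=[[\pi(x),a],\pi(y)]$ and $[a,[\pi(e),a]]=a$; irreducible if no subspace $0\ne W\ne V$ is invariant under $a$ and $\pi(A)$; $(\pi,a)$ on $V$ and $(\nu,b)$ on $W$ are equivalent if some isomorphism $f:V\to W$ has $f\pi(x)=\nu(x)f$, $fa=bf$. $\Phi(\rho)=(\rho|_{U_{-1}},-\rho(\bar A))$ for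 a representation $\rho$ of $L(A)$; $\rho$ on $V$ is $l$-graded if $V=V_1\oplus\dots\oplus V_l$, all $V_j\ne0$, $\rho(U_i)V_j\subset V_{i+j}$ ($V_m=0$ outside $1..l$); a generalized representation is of order $l$ if it is $\Phi(\rho)$ for some $l$-graded $\rho$. A usual representation is a linear $\phi:A\to\mathrm{End}\,V$ with $\phi(xy)=\phi(x)\phi(y)+\phi(y)\phi(x)$. A Jacobson representation is a linear $\phi:A\to\mathrm{End}\,V$ such that $A\oplus V$ with product $x*y=xy$, $u*v=0$, $x*v=v*x=\phi(x)v$ ($x,y\in A$, $u,v\in V$) is a Jordan algebra; irreducibility and equivalence of these are defined in the usual way (no proper nonzero invariant subspace; intertwining isomorphism). *)

theory Defs
  imports Complex_Main "Jordan_Normal_Form.Matrix"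
begin

(* Finite-dimensional complex spaces are modelled as C^m (carrier_vec m);
   linear endomorphisms of C^n as n x n complex matrices. *)

type_synonym cv = "complex vec"
type_synonym cm = "complex mat"
type_synonym jprod = "cv \<Rightarrow> cv \<Rightarrow> cv"

definition csubspace :: "nat \<Rightarrow> cv set \<Rightarrow> bool" where
  "csubspace n W \<longleftrightarrow> W \<subseteq> carrier_vec n \<and> 0\<^sub>v n \<in> W \<and>
     (\<forall>u\<in>W. \<forall>v\<in>W. u + v \<in> W) \<and> (\<forall>c. \<forall>u\<in>W. c \<cdot>\<^sub>v u \<in> W)"

definition bilinear_on :: "nat \<Rightarrow> jprod \<Rightarrow> bool" where
  "bilinear_on m jm \<longleftrightarrow>
     (\<forall>x\<in>carrier_vec m. \<forall>y\<in>carrier_vec m. jm x y \<in> carrier_vec m) \<and>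
     (\<forall>x\<in>carrier_vec m. \<forall>x'\<in>carrier_vec m. \<forall>y\<in>carrier_vec m.
        jm (x + x') y = jm x y + jm x' y \<and> jm y (x + x') = jm y x + jm y x') \<and>
     (\<forall>c. \<forall>x\<in>carrier_vec m. \<forall>y\<in>carrier_vec m.
        jm (c \<cdot>\<^sub>v x) y = c \<cdot>\<^sub>v jm x y \<and> jm y (c \<cdot>\<^sub>v x) = c \<cdot>\<^sub>v jm y x)"

definition jordan_identity :: "'b set \<Rightarrow> ('b \<Rightarrow> 'b \<Rightarrow> 'b) \<Rightarrow> bool" where
  "jordan_identity C jm \<longleftrightarrow>
     (\<forall>x\<in>C. \<forall>y\<in>C. jm x y = jm y x) \<and>
     (\<forall>x\<in>C. \<forall>y\<in>C. jm (jm (jm x x) y) x = jm (jm x x) (jm y x))"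

definition jordan_algebra :: "nat \<Rightarrow> jprod \<Rightarrow> bool" where
  "jordan_algebra m jm \<longleftrightarrow> bilinear_on m jm \<and> jordan_identity (carrier_vec m) jm"

definition jordan_unit :: "nat \<Rightarrow> jprod \<Rightarrow> cv \<Rightarrow> bool" where
  "jordan_unit m jm e \<longleftrightarrow> e \<in> carrier_vec m \<and> (\<forall>x\<in>carrier_vec m. jm e x = x)"

definition jideal :: "nat \<Rightarrow> jprod \<Rightarrow> cv set \<Rightarrow> bool" where
  "jideal m jm I \<longleftrightarrow> csubspace m I \<and> (\<forall>x\<in>carrier_vec m. \<forall>y\<in>I. jm x y \<in> I)"

definition simple_alg :: "nat \<Rightarrow> jprod \<Rightarrow> bool" where
  "simple_alg m jm \<longleftrightarrow> m > 0 \<and>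
     (\<exists>x\<in>carrier_vec m. \<exists>y\<in>carrier_vec m. jm x y \<noteq> 0\<^sub>v m) \<and>
     (\<forall>I. jideal m jm I \<longrightarrow> I = {0\<^sub>v m} \<or> I = carrier_vec m)"

definition lin_map :: "nat \<Rightarrow> nat \<Rightarrow> (cv \<Rightarrow> cm) \<Rightarrow> bool" where
  "lin_map m n f \<longleftrightarrow> (\<forall>x\<in>carrier_vec m. f x \<in> carrier_mat n n) \<and>
     (\<forall>x\<in>carrier_vec m. \<forall>y\<in>carrier_vec m. f (x + y) = f x + f y) \<and>
     (\<forall>c. \<forall>x\<in>carrier_vec m. f (c \<cdot>\<^sub>v x) = c \<cdot>\<^sub>m f x)"

definition comm :: "cm \<Rightarrow> cm \<Rightarrow> cm" where
  "comm X Y = X * Y - Y * X"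

definition genrep :: "nat \<Rightarrow> jprod \<Rightarrow> cv \<Rightarrow> nat \<Rightarrow> (cv \<Rightarrow> cm) \<Rightarrow> cm \<Rightarrow> bool" where
  "genrep m jm e n \<pi> a \<longleftrightarrow> lin_map m n \<pi> \<and> a \<in> carrier_mat n n \<and>
     (\<forall>x\<in>carrier_vec m. \<forall>y\<in>carrier_vec m. \<pi> (jm x y) = comm (comm (\<pi> x) a) (\<pi> y)) \<and>
     comm a (comm (\<pi> e) a) = a"

definition irreducible_fam :: "nat \<Rightarrow> cm set \<Rightarrow> bool" where
  "irreducible_fam n F \<longleftrightarrow> n > 0 \<and>
     \<not> (\<exists>W. csubspace n W \<and> W \<noteq> {0\<^sub>v n} \<and> W \<noteq> carrier_vec n \<and>
           (\<forall>X\<in>F. \<forall>w\<in>W. X *\<^sub>v w \<in> W))"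

definition gen_equiv :: "nat \<Rightarrow> nat \<Rightarrow> (cv \<Rightarrow> cm) \<Rightarrow> cm \<Rightarrow> nat \<Rightarrow> (cv \<Rightarrow> cm) \<Rightarrow> cm \<Rightarrow> bool" where
  "gen_equiv m n \<pi> a n' \<pi>' a' \<longleftrightarrow> n = n' \<and>
     (\<exists>F\<in>carrier_mat n n. invertible_mat F \<and>
        (\<forall>x\<in>carrier_vec m. F * \<pi> x = \<pi>' x * F) \<and> F * a = a' * F)"

(* U_{-1} = carrier_vec m; U_0 \<subseteq> m x m matrices (End A); U_1 \<subseteq> bilinear maps
   A x A -> A, represented by functions that are 0 outside carrier x carrier. *)

definition bres :: "nat \<Rightarrow> jprod \<Rightarrow> jprod" where
  "bres m B = (\<lambda>x y. if x \<in> carrier_vec m \<and> y \<in> carrier_vec m then B x y else 0\<^sub>v m)"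

definition Lmat :: "nat \<Rightarrow> jprod \<Rightarrow> cv \<Rightarrow> cm" where
  "Lmat m jm a = mat m m (\<lambda>(i, j). jm a (unit_vec m j) $ i)"

definition Abar :: "nat \<Rightarrow> jprod \<Rightarrow> jprod" where
  "Abar m jm = bres m jm"

definition Aa :: "nat \<Rightarrow> jprod \<Rightarrow> cv \<Rightarrow> jprod" where
  "Aa m jm a = bres m (\<lambda>x y. jm (jm x a) y + jm (jm y a) x - jm a (jm x y))"

inductive_set U0 :: "nat \<Rightarrow> jprod \<Rightarrow> cm set" for m jm where
  U0_zero: "0\<^sub>m m m \<in> U0 m jm"
| U0_L: "a \<in> carrier_vec m \<Longrightarrow> Lmat m jm a \<in> U0 m jm"
| U0_comm: "a \<in> carrier_vec m \<Longrightarrow> b \<in> carrier_vec m \<Longrightarrow>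
     comm (Lmat m jm a) (Lmat m jm b) \<in> U0 m jm"
| U0_add: "S \<in> U0 m jm \<Longrightarrow> T \<in> U0 m jm \<Longrightarrow> S + T \<in> U0 m jm"
| U0_smult: "S \<in> U0 m jm \<Longrightarrow> c \<cdot>\<^sub>m S \<in> U0 m jm"

inductive_set U1 :: "nat \<Rightarrow> jprod \<Rightarrow> jprod set" for m jm where
  U1_zero: "(\<lambda>x y. 0\<^sub>v m) \<in> U1 m jm"
| U1_Abar: "Abar m jm \<in> U1 m jm"
| U1_Aa: "a \<in> carrier_vec m \<Longrightarrow> Aa m jm a \<in> U1 m jm"
| U1_add: "B \<in> U1 m jm \<Longrightarrow> B' \<in> U1 m jm \<Longrightarrow> (\<lambda>x y. B x y + B' x y) \<in> U1 m jm"
| U1_smult: "B \<in> U1 m jm \<Longrightarrow> (\<lambda>x y. c \<cdot>\<^sub>v B x y) \<in> U1 m jm"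

definition br_Ba :: "nat \<Rightarrow> jprod \<Rightarrow> cv \<Rightarrow> cm" where
  "br_Ba m B a = mat m m (\<lambda>(i, j). B a (unit_vec m j) $ i)"

definition br_SB :: "nat \<Rightarrow> cm \<Rightarrow> jprod \<Rightarrow> jprod" where
  "br_SB m S B = bres m (\<lambda>x y. S *\<^sub>v B x y - B (S *\<^sub>v x) y - B x (S *\<^sub>v y))"

(* A representation rho of L(A) on C^n, given by its (linear) restrictions
   rm, r0, r1 to U_{-1}, U_0, U_1, preserving all brackets *)
definition lie_rep :: "nat \<Rightarrow> jprod \<Rightarrow> nat \<Rightarrow> (cv \<Rightarrow> cm) \<Rightarrow> (cm \<Rightarrow> cm) \<Rightarrow> (jprod \<Rightarrow> cm) \<Rightarrow> bool" where
  "lie_rep m jm n rm r0 r1 \<longleftrightarrow>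
     lin_map m n rm \<and>
     (\<forall>S\<in>U0 m jm. r0 S \<in> carrier_mat n n) \<and>
     (\<forall>S\<in>U0 m jm. \<forall>T\<in>U0 m jm. r0 (S + T) = r0 S + r0 T) \<and>
     (\<forall>c. \<forall>S\<in>U0 m jm. r0 (c \<cdot>\<^sub>m S) = c \<cdot>\<^sub>m r0 S) \<and>
     (\<forall>B\<in>U1 m jm. r1 B \<in> carrier_mat n n) \<and>
     (\<forall>B\<in>U1 m jm. \<forall>B'\<in>U1 m jm. r1 (\<lambda>x y. B x y + B' x y) = r1 B + r1 B') \<and>
     (\<forall>c. \<forall>B\<in>U1 m jm. r1 (\<lambda>x y. c \<cdot>\<^sub>v B x y) = c \<cdot>\<^sub>m r1 B) \<and>
     (\<forall>a\<in>carrier_vec m. \<forall>b\<in>carrier_vec m. comm (rm a) (rm b) = 0\<^sub>m n n) \<and>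
     (\<forall>B\<in>U1 m jm. \<forall>B'\<in>U1 m jm. comm (r1 B) (r1 B') = 0\<^sub>m n n) \<and>
     (\<forall>S\<in>U0 m jm. \<forall>a\<in>carrier_vec m. comm (r0 S) (rm a) = rm (S *\<^sub>v a)) \<and>
     (\<forall>S\<in>U0 m jm. \<forall>T\<in>U0 m jm. comm (r0 S) (r0 T) = r0 (comm S T)) \<and>
     (\<forall>B\<in>U1 m jm. \<forall>a\<in>carrier_vec m. comm (r1 B) (rm a) = r0 (br_Ba m B a)) \<and>
     (\<forall>S\<in>U0 m jm. \<forall>B\<in>U1 m jm. comm (r0 S) (r1 B) = r1 (br_SB m S B))"

fun vsum :: "nat \<Rightarrow> (nat \<Rightarrow> cv) \<Rightarrow> nat \<Rightarrow> cv" where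
  "vsum n f 0 = 0\<^sub>v n"
| "vsum n f (Suc k) = vsum n f k + f (Suc k)"

definition graded_decomp :: "nat \<Rightarrow> nat \<Rightarrow> (nat \<Rightarrow> cv set) \<Rightarrow> bool" where
  "graded_decomp n l Vs \<longleftrightarrow>
     (\<forall>j\<in>{1..l}. csubspace n (Vs j) \<and> Vs j \<noteq> {0\<^sub>v n}) \<and>
     (\<forall>v\<in>carrier_vec n. \<exists>f. (\<forall>j\<in>{1..l}. f j \<in> Vs j) \<and> v = vsum n f l) \<and>
     (\<forall>f. (\<forall>j\<in>{1..l}. f j \<in> Vs j) \<and> vsum n f l = 0\<^sub>v n \<longrightarrow> (\<forall>j\<in>{1..l}. f j = 0\<^sub>v n))"

definition Vz :: "nat \<Rightarrow> nat \<Rightarrow> (nat \<Rightarrow> cv set) \<Rightarrow> int \<Rightarrow> cv set" where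
  "Vz n l Vs k = (if 1 \<le> k \<and> k \<le> int l then Vs (nat k) else {0\<^sub>v n})"

definition l_graded :: "nat \<Rightarrow> jprod \<Rightarrow> nat \<Rightarrow> nat \<Rightarrow> (cv \<Rightarrow> cm) \<Rightarrow> (cm \<Rightarrow> cm) \<Rightarrow> (jprod \<Rightarrow> cm) \<Rightarrow> bool" where
  "l_graded m jm n l rm r0 r1 \<longleftrightarrow> lie_rep m jm n rm r0 r1 \<and>
     (\<exists>Vs. graded_decomp n l Vs \<and>
        (\<forall>j\<in>{1..l}. \<forall>v\<in>Vs j.
           (\<forall>a\<in>carrier_vec m. rm a *\<^sub>v v \<in> Vz n l Vs (int j - 1)) \<and>
           (\<forall>S\<in>U0 m jm. r0 S *\<^sub>v v \<in> Vz n l Vs (int j)) \<and>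
           (\<forall>B\<in>U1 m jm. r1 B *\<^sub>v v \<in> Vz n l Vs (int j + 1))))"

definition genrep_order :: "nat \<Rightarrow> jprod \<Rightarrow> cv \<Rightarrow> nat \<Rightarrow> nat \<Rightarrow> (cv \<Rightarrow> cm) \<Rightarrow> cm \<Rightarrow> bool" where
  "genrep_order m jm e n l \<pi> a \<longleftrightarrow> genrep m jm e n \<pi> a \<and>
     (\<exists>rm r0 r1. l_graded m jm n l rm r0 r1 \<and>
        (\<forall>x\<in>carrier_vec m. \<pi> x = rm x) \<and> a = - r1 (Abar m jm))"

definition usual_rep :: "nat \<Rightarrow> jprod \<Rightarrow> nat \<Rightarrow> (cv \<Rightarrow> cm) \<Rightarrow> bool" where
  "usual_rep m jm n \<phi> \<longleftrightarrow> lin_map m n \<phi> \<and>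
     (\<forall>x\<in>carrier_vec m. \<forall>y\<in>carrier_vec m. \<phi> (jm x y) = \<phi> x * \<phi> y + \<phi> y * \<phi> x)"

(* A \<oplus> V with (x,u)*(y,v) = (xy, phi(x)v + phi(y)u) is a Jordan algebra
   (bilinearity of this product is automatic from linearity of phi) *)
definition jacobson_rep :: "nat \<Rightarrow> jprod \<Rightarrow> nat \<Rightarrow> (cv \<Rightarrow> cm) \<Rightarrow> bool" where
  "jacobson_rep m jm n \<phi> \<longleftrightarrow> lin_map m n \<phi> \<and>
     jordan_identity (carrier_vec m \<times> carrier_vec n)
       (\<lambda>(x, u) (y, v). (jm x y, \<phi> x *\<^sub>v v + \<phi> y *\<^sub>v u))"

definition rep_equiv :: "nat \<Rightarrow> nat \<Rightarrow> (cv \<Rightarrow> cm) \<Rightarrow> nat \<Rightarrow> (cv \<Rightarrow> cm) \<Rightarrow> bool" where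
  "rep_equiv m n \<phi> n' \<phi>' \<longleftrightarrow> n = n' \<and>
     (\<exists>F\<in>carrier_mat n n. invertible_mat F \<and> (\<forall>x\<in>carrier_vec m. F * \<phi> x = \<phi>' x * F))"

definition fin_up_to :: "('r \<Rightarrow> bool) \<Rightarrow> ('r \<Rightarrow> 'r \<Rightarrow> bool) \<Rightarrow> bool" where
  "fin_up_to P E \<longleftrightarrow> (\<exists>S. finite S \<and> (\<forall>r. P r \<longrightarrow> (\<exists>s\<in>S. E r s)))"

end

theory Submission
  imports Defs
begin

text \<open>
  Let \<open>L(A)\<close> act on the product of all \<open>l\<close>-graded representations, that is, by families of matrices.
  It suffices to show that the algebra of families generated by \<open>U\<^sub>-\<^sub>1\<close> and \<open>U\<^sub>1\<close> is finite
  dimensional, because inequivalent irreducible representations are separated by linearly independent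
  elements of it. Any product of \<open>l\<close> elements of \<open>U\<^sub>-\<^sub>1\<close>, or of \<open>U\<^sub>1\<close>, vanishes. With \<open>t = [q, p]\<close>,
  moving the \<open>q\<close>'s to the right in \<open>0 = q\<^sup>l p\<^sup>l\<close> gives \<open>t\<^sup>l = 0\<close> modulo ordered products
  \<open>U\<^sub>-\<^sub>1\<dots> U\<^sub>0\<dots> U\<^sub>1\<dots>\<close> with fewer than \<open>l\<close> factors from \<open>U\<^sub>0\<close>. As such \<open>t\<close> span \<open>U\<^sub>0\<close>, the number of
  \<open>U\<^sub>0\<close>-factors needed in a Poincare-Birkhoff-Witt type spanning set is bounded.

  Usual and Jacobson representations both satisfy
  \<open>\<phi>(x)\<phi>(y)\<phi>(z) + \<phi>(z)\<phi>(y)\<phi>(x) = \<phi>(xy)\<phi>(z) + \<phi>(yz)\<phi>(x) + \<phi>(xz)\<phi>(y) - \<phi>((xz)y)\<close>, so words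
  in \<open>\<phi>\<close> of a basis are, modulo shorter ones, alternating in the letters at odd positions and hence
  of bounded length.
\<close>

section \<open>Complex algebras\<close>

text \<open>The dimensions of the representations are not bounded in advance, so any bound has to
  come from \<open>m\<close> and \<open>l\<close> alone. The obstacle is U_0: the grading makes
  U_{-1} and U_1 act nilpotently, whereas U_0 preserves every V_j, so words in it have no evident
  length bound. The cure is a pigeonhole. Up to m^2 brackets form \<open>T\<close>, and a word with
  more than card T * (l - 1) letters repeats one of them l times; the copies can be gathered into a
  power t^l and traded for fewer U_0-factors. One left factor from \<open>Q\<close> adds at most one
  U_0-factor, so it is enough to absorb a single extra one.

  Separation does without a density theorem: an irreducible representation is evaluated on one
  nonzero vector, which presents its space as a quotient of a left ideal, and equal kernels force
  equivalence.

  Usual and Jacobson representations are not passed through Phi; their cubic identity is used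
  directly.\<close>

locale complex_algebra = vector_space scale
  for scale :: "complex \<Rightarrow> 'e::ring_1 \<Rightarrow> 'e" (infixr \<open>*s\<close> 75) +
  assumes scale_mult_left: "(c *s x) * y = c *s (x * y)"
    and scale_mult_right: "x * (c *s y) = c *s (x * y)"
begin

lemma span_mult_subspace:
  assumes x: "x \<in> span X" and y: "y \<in> span Y" and U: "subspace U"
    and XY: "\<And>a b. a \<in> X \<Longrightarrow> b \<in> Y \<Longrightarrow> a * b \<in> U"
  shows "x * y \<in> U"
proof -
  have 1: "a * y \<in> U" if a: "a \<in> X" for a
    using y
  proof (induction rule: span_induct_alt)
    case base show ?case using U by (simp add: subspace_0)
  next
    case (step c b z)
    then show ?case using XY[OF a] U
      by (simp add: distrib_left scale_mult_right subspace_add subspace_scale)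
  qed
  show ?thesis
    using x
  proof (induction rule: span_induct_alt)
    case base show ?case using U by (simp add: subspace_0)
  next
    case (step c b z)
    then show ?case using 1 U
      by (simp add: distrib_right scale_mult_left subspace_add subspace_scale)
  qed
qed

lemma span_mult_left_subspace:
  assumes "x \<in> span X" "subspace U" "\<And>a. a \<in> X \<Longrightarrow> a * y \<in> U"
  shows "x * y \<in> U"
  by (rule span_mult_subspace[OF assms(1) span_base[of y "{y}"] assms(2)]) (use assms(3) in simp_all)

lemma span_mult_right_subspace:
  assumes "x \<in> span X" "subspace U" "\<And>a. a \<in> X \<Longrightarrow> y * a \<in> U"
  shows "y * x \<in> U"
  by (rule span_mult_subspace[OF span_base[of y "{y}"] assms(1,2)]) (use assms(3) in simp_all)

text \<open>The word-length filtration of the unital subalgebra \<open>alg X\<close>; the empty word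
  supplies 1 in every layer.\<close>

definition fil :: "'e set \<Rightarrow> nat \<Rightarrow> 'e set" where
  "fil X d = span {prod_list xs | xs. set xs \<subseteq> X \<and> length xs \<le> d}"

definition alg :: "'e set \<Rightarrow> 'e set" where
  "alg X = span {prod_list xs | xs. set xs \<subseteq> X}"

lemma subspace_fil [simp]: "subspace (fil X d)"
  by (simp add: fil_def)

lemma subspace_alg [simp]: "subspace (alg X)"
  by (simp add: alg_def)

lemma prod_list_in_fil: "set xs \<subseteq> X \<Longrightarrow> length xs \<le> d \<Longrightarrow> prod_list xs \<in> fil X d"
  unfolding fil_def by (rule span_base) blast

lemma prod_list_in_alg: "set xs \<subseteq> X \<Longrightarrow> prod_list xs \<in> alg X"
  unfolding alg_def by (rule span_base) blast

lemma fil_mono: "d \<le> d' \<Longrightarrow> fil X d \<subseteq> fil X d'"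
  unfolding fil_def by (rule span_mono) auto

lemma one_in_fil: "1 \<in> fil X d"
  using prod_list_in_fil[of "[]" X d] by simp

lemma one_in_alg: "1 \<in> alg X"
  using prod_list_in_alg[of "[]" X] by simp

lemma span_subset_fil: "d \<ge> 1 \<Longrightarrow> span X \<subseteq> fil X d"
proof (rule span_minimal)
  assume "d \<ge> 1"
  then show "X \<subseteq> fil X d" using prod_list_in_fil[of "[x]" X d for x] by auto
qed simp

lemma span_subset_alg: "span X \<subseteq> alg X"
proof (rule span_minimal)
  show "X \<subseteq> alg X" using prod_list_in_alg[of "[x]" X for x] by auto
qed simp

lemma fil_induct :
  assumes "x \<in> fil X d" "subspace U"
    "\<And>xs. set xs \<subseteq> X \<Longrightarrow> length xs \<le> d \<Longrightarrow> prod_list xs \<in> U"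
  shows "x \<in> U"
  using assms span_minimal[of "{prod_list xs | xs. set xs \<subseteq> X \<and> length xs \<le> d}" U]
  unfolding fil_def by blast

lemma fil_mult:
  assumes "x \<in> fil X d" "y \<in> fil X d'"
  shows "x * y \<in> fil X (d + d')"
  using assms(1,2)[unfolded fil_def]
proof (rule span_mult_subspace)
  fix a b
  assume "a \<in> {prod_list xs |xs. set xs \<subseteq> X \<and> length xs \<le> d}"
    "b \<in> {prod_list xs |xs. set xs \<subseteq> X \<and> length xs \<le> d'}"
  then obtain xs ys where "a = prod_list xs" "b = prod_list ys" "set (xs @ ys) \<subseteq> X"
    "length (xs @ ys) \<le> d + d'" by auto
  then show "a * b \<in> fil X (d + d')" using prod_list_in_fil[of "xs @ ys" X "d + d'"] by simp
qed simp

lemma alg_mult: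
  assumes "x \<in> alg X" "y \<in> alg X"
  shows "x * y \<in> alg X"
  using assms(1,2)[unfolded alg_def]
proof (rule span_mult_subspace)
  fix a b
  assume "a \<in> {prod_list xs |xs. set xs \<subseteq> X}" "b \<in> {prod_list xs |xs. set xs \<subseteq> X}"
  then obtain xs ys where "a = prod_list xs" "b = prod_list ys" "set (xs @ ys) \<subseteq> X" by auto
  then show "a * b \<in> alg X" using prod_list_in_alg[of "xs @ ys" X] by simp
qed simp

lemma alg_power: "x \<in> alg X \<Longrightarrow> x ^ k \<in> alg X"
  by (induction k) (auto simp: one_in_alg alg_mult)

lemma fil_power: "x \<in> span X \<Longrightarrow> x ^ k \<in> fil X k"
proof (induction k)
  case (Suc k)
  then show ?case using fil_mult[of x X 1 "x ^ k" k] span_subset_fil[of 1 X] by auto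
qed (simp add: one_in_fil)

lemma commutator_linear:
  "a * (c *s x + y) - (c *s x + y) * b = c *s (a * x - x * b) + (a * y - y * b)"
  by (simp add: algebra_simps scale_mult_left scale_mult_right)

lemma commutator_linear':
  "(c *s x + y) * b - b * (c *s x + y) = c *s (x * b - b * x) + (y * b - b * y)"
  by (simp add: algebra_simps scale_mult_left scale_mult_right)

lemma subspace_commutator:
  assumes U: "subspace U" shows "subspace {x. a * x - x * b \<in> U}"
proof (rule subspaceI)
  fix x y c assume "x \<in> {x. a * x - x * b \<in> U}" "y \<in> {x. a * x - x * b \<in> U}"
  moreover have "a * (x + y) - (x + y) * b = (a * x - x * b) + (a * y - y * b)"
    by (simp add: algebra_simps)
  ultimately show "x + y \<in> {x. a * x - x * b \<in> U}"
    using U by (simp only: mem_Collect_eq subspace_add)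
next
  fix x c assume "x \<in> {x. a * x - x * b \<in> U}"
  moreover have "a * (c *s x) - (c *s x) * b = c *s (a * x - x * b)"
    by (simp add: scale_mult_left scale_mult_right scale_right_diff_distrib)
  ultimately show "c *s x \<in> {x. a * x - x * b \<in> U}"
    using U by (simp only: mem_Collect_eq subspace_scale)
qed (use subspace_0[OF U] in simp)

lemma subspace_mult_right_vimage: "subspace U \<Longrightarrow> subspace {x. x * b \<in> U}"
  by (rule subspaceI) (simp_all add: scale_mult_left distrib_right subspace_0 subspace_add subspace_scale)

lemma subspace_mult_left_vimage: "subspace U \<Longrightarrow> subspace {x. b * x \<in> U}"
  by (rule subspaceI) (simp_all add: scale_mult_right distrib_left subspace_0 subspace_add subspace_scale)

text \<open>The commutator with \<open>t\<close> is a derivation, so by the Leibniz rule its values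
  on generators decide.\<close>

lemma commutator_alg:
  assumes t: "\<And>p. p \<in> X \<Longrightarrow> t * p - p * t \<in> alg X" and x: "x \<in> alg X"
  shows "t * x - x * t \<in> alg X"
proof -
  have *: "t * prod_list xs - prod_list xs * t \<in> alg X" if "set xs \<subseteq> X" for xs
    using that
  proof (induction xs)
    case Nil then show ?case using subspace_0[OF subspace_alg] by simp
  next
    case (Cons p xs)
    have "t * prod_list (p # xs) - prod_list (p # xs) * t
      = (t * p - p * t) * prod_list xs + p * (t * prod_list xs - prod_list xs * t)"
      by (simp add: algebra_simps)
    moreover have "(t * p - p * t) * prod_list xs \<in> alg X"
      using Cons.prems by (intro alg_mult t prod_list_in_alg) auto
    moreover have "p * (t * prod_list xs - prod_list xs * t) \<in> alg X"
      using Cons span_subset_alg[of X] span_base[of p X] by (intro alg_mult) auto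
    ultimately show ?case by (simp only: subspace_add[OF subspace_alg])
  qed
  have "span {prod_list xs | xs. set xs \<subseteq> X} \<subseteq> {x. t * x - x * t \<in> alg X}"
    by (rule span_minimal) (auto simp: subspace_commutator *)
  then show ?thesis using x by (auto simp: alg_def)
qed

text \<open>In the Leibniz expansion each summand replaces one letter by an element of span X, so
  the length does not grow. Since t times the word has one letter more, \<open>t\<close> commutes
  with words modulo shorter ones.\<close>

lemma commutator_fil:
  assumes t: "\<And>s. s \<in> X \<Longrightarrow> t * s - s * t \<in> span X" and xs: "set xs \<subseteq> X"
  shows "t * prod_list xs - prod_list xs * t \<in> fil X (length xs)"
  using xs
proof (induction xs)
  case Nil then show ?case using subspace_0[OF subspace_fil] by simp
next
  case (Cons p xs)
  have "t * prod_list (p # xs) - prod_list (p # xs) * t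
      = (t * p - p * t) * prod_list xs + p * (t * prod_list xs - prod_list xs * t)"
    by (simp add: algebra_simps)
  moreover have "(t * p - p * t) * prod_list xs \<in> fil X (1 + length xs)"
    using Cons.prems t span_subset_fil[of 1 X] by (intro fil_mult prod_list_in_fil) auto
  moreover have "p * (t * prod_list xs - prod_list xs * t) \<in> fil X (1 + length xs)"
    using Cons span_subset_fil[of 1 X] span_base by (intro fil_mult) auto
  ultimately show ?case by (simp only: subspace_add[OF subspace_fil] list.size add_Suc_right add_Suc add_0_right One_nat_def add_0 add_0_left)
qed

end

section \<open>Ordered products in an associative envelope of a three-graded Lie algebra\<close>

locale three_graded_generation = complex_algebra scale
  for scale :: "complex \<Rightarrow> 'e::ring_1 \<Rightarrow> 'e" (infixr \<open>*s\<close> 75) +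
  fixes P Q T :: "'e set"
  assumes T_def: "T = {q * p - p * q | q p. q \<in> Q \<and> p \<in> P}"
    and TP: "t \<in> T \<Longrightarrow> p \<in> P \<Longrightarrow> t * p - p * t \<in> span P"
    and TQ: "t \<in> T \<Longrightarrow> q \<in> Q \<Longrightarrow> t * q - q * t \<in> span Q"
begin

text \<open>Only the middle factor is measured: words in \<open>P\<close> and in \<open>Q\<close>
  will be bounded by nilpotency, and the number of \<open>T\<close>-factors is the one quantity left
  to control.\<close>

definition M :: "nat \<Rightarrow> 'e set" where
  "M d = span {x * y * z | x y z. x \<in> alg P \<and> y \<in> fil T d \<and> z \<in> alg Q}"

lemma subspace_M [simp]: "subspace (M d)"
  by (simp add: M_def)

lemma M_I: "x \<in> alg P \<Longrightarrow> y \<in> fil T d \<Longrightarrow> z \<in> alg Q \<Longrightarrow> x * y * z \<in> M d"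
  unfolding M_def by (rule span_base) blast

lemma M_mono: "d \<le> d' \<Longrightarrow> M d \<subseteq> M d'"
  unfolding M_def using fil_mono[of d d' T] by (intro span_mono) blast

lemma M_induct :
  assumes "u \<in> M d" "subspace U"
    "\<And>x y z. x \<in> alg P \<Longrightarrow> y \<in> fil T d \<Longrightarrow> z \<in> alg Q \<Longrightarrow> x * y * z \<in> U"
  shows "u \<in> U"
  using assms span_minimal[of "{x * y * z | x y z. x \<in> alg P \<and> y \<in> fil T d \<and> z \<in> alg Q}" U]
  unfolding M_def by blast

lemma one_in_M: "1 \<in> M d"
  using M_I[OF one_in_alg one_in_fil one_in_alg] by simp

lemma alg_mult_M:
  assumes "u \<in> M d" "x \<in> alg P" shows "x * u \<in> M d"
proof -
  have "u \<in> {u. x * u \<in> M d}" using assms(1)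
  proof (rule M_induct)
    fix a b c assume "a \<in> alg P" "b \<in> fil T d" "c \<in> alg Q"
    then show "a * b * c \<in> {u. x * u \<in> M d}"
      using M_I[OF alg_mult[OF assms(2)]] by (simp add: mult.assoc)
  qed (simp add: subspace_mult_left_vimage)
  then show ?thesis by simp
qed

lemma M_mult_alg:
  assumes "u \<in> M d" "z \<in> alg Q" shows "u * z \<in> M d"
proof -
  have "u \<in> {u. u * z \<in> M d}" using assms(1)
  proof (rule M_induct)
    fix a b c assume *: "a \<in> alg P" "b \<in> fil T d" "c \<in> alg Q"
    then show "a * b * c \<in> {u. u * z \<in> M d}"
      using M_I[OF *(1,2) alg_mult[OF *(3) assms(2)]] by (simp add: mult.assoc)
  qed (simp add: subspace_mult_right_vimage)
  then show ?thesis by simp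
qed

lemma commutator_T_alg_P: "t \<in> T \<Longrightarrow> x \<in> alg P \<Longrightarrow> t * x - x * t \<in> alg P"
  by (rule commutator_alg) (rule subsetD[OF span_subset_alg TP])

lemma commutator_T_alg_Q: "t \<in> T \<Longrightarrow> x \<in> alg Q \<Longrightarrow> t * x - x * t \<in> alg Q"
  by (rule commutator_alg) (rule subsetD[OF span_subset_alg TQ])

lemma T_in_fil: "t \<in> T \<Longrightarrow> t \<in> fil T 1"
  using span_subset_fil[of 1 T] span_base by auto

text \<open>The new factor has to cross an element of \<open>alg Q\<close>; the correction stays in
  \<open>alg Q\<close> and carries no further \<open>T\<close>-factor.\<close>

lemma M_mult_T:
  assumes "u \<in> M d" "t \<in> T" shows "u * t \<in> M (Suc d)"
proof -
  have "u \<in> {u. u * t \<in> M (Suc d)}" using assms(1)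
  proof (rule M_induct)
    fix x y z assume *: "x \<in> alg P" "y \<in> fil T d" "z \<in> alg Q"
    have "x * y * z * t = x * (y * t) * z - x * y * (t * z - z * t)"
      by (simp add: algebra_simps)
    moreover have "x * (y * t) * z \<in> M (Suc d)"
      using M_I[OF *(1) _ *(3)] fil_mult[OF *(2) T_in_fil[OF assms(2)]] by simp
    moreover have "x * y * (t * z - z * t) \<in> M (Suc d)"
      using M_I[OF *(1,2) commutator_T_alg_Q[OF assms(2) *(3)]] M_mono[of d "Suc d"] by auto
    ultimately show "x * y * z \<in> {u. u * t \<in> M (Suc d)}" by (simp add: subspace_diff)
  qed (simp add: subspace_mult_right_vimage)
  then show ?thesis by simp
qed

lemma M_mult_T_word:
  assumes "u \<in> M d" "set ts \<subseteq> T" shows "u * prod_list ts \<in> M (d + length ts)"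
  using assms
proof (induction ts arbitrary: u d)
  case (Cons t ts)
  then have "(u * t) * prod_list ts \<in> M (Suc d + length ts)"
    by (intro Cons.IH M_mult_T) auto
  then show ?case by (simp add: mult.assoc)
qed simp

text \<open>Crossing a letter of \<open>T\<close> turns \<open>q\<close> into another element of
  span Q and creates no \<open>T\<close>-letter. The induction therefore runs over all of span Q and
  not over \<open>Q\<close> only.\<close>

lemma Q_mult_T_word:
  assumes "q \<in> span Q" "set ts \<subseteq> T"
  shows "q * prod_list ts \<in> span {y * z | y z. y \<in> fil T (length ts) \<and> z \<in> alg Q}"
    (is "_ \<in> span (?K (length ts))")
  using assms
proof (induction ts arbitrary: q)
  case Nil
  then have "1 * q \<in> span (?K 0)"
    using span_subset_alg one_in_fil by (intro span_base) blast
  then show ?case by simp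
next
  case (Cons t ts)
  then have t: "t \<in> T" by simp
  have "t * q - q * t \<in> span Q"
    using Cons.prems(1)
  proof (induction rule: span_induct_alt)
    case (step c x y)
    then show ?case using TQ[OF t] by (simp add: commutator_linear span_add span_scale)
  qed (simp add: span_zero)
  then have q': "q * t - t * q \<in> span Q" using span_neg by fastforce
  have "(q * t - t * q) * prod_list ts \<in> span (?K (length ts))"
    using Cons q' by simp
  then have 1: "(q * t - t * q) * prod_list ts \<in> span (?K (Suc (length ts)))"
  proof (rule subsetD[OF span_mono, rotated])
    show "?K (length ts) \<subseteq> ?K (Suc (length ts))"
      using fil_mono[of "length ts" "Suc (length ts)" T] by auto
  qed
  have "q * prod_list ts \<in> span (?K (length ts))" using Cons by simp
  then have 2: "t * (q * prod_list ts) \<in> span (?K (Suc (length ts)))"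
  proof (rule span_mult_right_subspace)
    fix a assume "a \<in> ?K (length ts)"
    then obtain y z where "a = y * z" "y \<in> fil T (length ts)" "z \<in> alg Q" by blast
    then have "t * a = (t * y) * z" "t * y \<in> fil T (Suc (length ts))"
      using fil_mult[OF T_in_fil[OF t]] by (auto simp: mult.assoc)
    then show "t * a \<in> span (?K (Suc (length ts)))"
      using \<open>z \<in> alg Q\<close> by (intro span_base) blast
  qed simp
  have "q * prod_list (t # ts) = (q * t - t * q) * prod_list ts + t * (q * prod_list ts)"
    by (simp add: algebra_simps)
  then show ?case using span_add[OF 1 2] by simp
qed

lemma Q_mult_fil:
  assumes q: "q \<in> Q" and y: "y \<in> fil T d" shows "q * y \<in> M d"
proof -
  have "y \<in> {y. q * y \<in> M d}" using y
  proof (rule fil_induct)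
    fix ts assume ts: "set ts \<subseteq> T" "length ts \<le> d"
    have "span {y * z | y z. y \<in> fil T (length ts) \<and> z \<in> alg Q} \<subseteq> M (length ts)"
      using M_I[OF one_in_alg, of _ "length ts"] by (intro span_minimal) auto
    then show "prod_list ts \<in> {y. q * y \<in> M d}"
      using Q_mult_T_word[of q ts] span_base[OF q] ts M_mono[of "length ts" d] by auto
  qed (simp add: subspace_mult_left_vimage)
  then show ?thesis by simp
qed

text \<open>Crossing a word in \<open>P\<close>, \<open>q\<close> can turn into a bracket [q, p] in
  \<open>T\<close>, which afterwards only changes \<open>P\<close>-factors into
  \<open>P\<close>-factors. Thus at most one \<open>T\<close>-factor arises, and crossing the middle
  factor adds none.\<close>

lemma Q_mult_M:
  assumes q: "q \<in> Q" and u: "u \<in> M d" shows "q * u \<in> M (Suc d)"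
proof -
  \<comment> \<open>Since \<open>fil T 1\<close> contains 1, this space also holds the corrections
    without a \<open>T\<close>-factor.\<close>
  let ?N = "span {x * t | x t. x \<in> alg P \<and> t \<in> fil T 1}"
  have qx: "q * prod_list ps - prod_list ps * q \<in> ?N" if "set ps \<subseteq> P" for ps
    using that
  proof (induction ps)
    case Nil then show ?case by (simp add: span_zero)
  next
    case (Cons p ps)
    let ?t = "q * p - p * q" and ?w = "prod_list ps"
    have t: "?t \<in> T" unfolding T_def using q Cons.prems by auto
    have w: "?w \<in> alg P" using Cons.prems by (simp add: prod_list_in_alg)
    have "?w * ?t \<in> ?N" using w T_in_fil[OF t] by (intro span_base) blast
    moreover have "(?t * ?w - ?w * ?t) * 1 \<in> ?N"
      using commutator_T_alg_P[OF t w] one_in_fil by (intro span_base) blast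
    moreover have "p * (q * ?w - ?w * q) \<in> ?N"
    proof (rule span_mult_right_subspace)
      show "q * ?w - ?w * q \<in> ?N" using Cons by simp
      fix a assume "a \<in> {x * t | x t. x \<in> alg P \<and> t \<in> fil T 1}"
      then obtain x t where "a = x * t" "x \<in> alg P" "t \<in> fil T 1" by blast
      moreover have "p \<in> alg P" using Cons.prems span_subset_alg span_base by auto
      ultimately have "p * a = (p * x) * t" "p * x \<in> alg P" by (auto simp: mult.assoc alg_mult)
      then show "p * a \<in> ?N" using \<open>t \<in> fil T 1\<close> by (intro span_base) blast
    qed simp
    moreover have "q * prod_list (p # ps) - prod_list (p # ps) * q
      = ?w * ?t + (?t * ?w - ?w * ?t) * 1 + p * (q * ?w - ?w * q)"
      by (simp add: algebra_simps)
    ultimately show ?case by (simp only: span_add)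
  qed
  have qx: "q * x - x * q \<in> ?N" if "x \<in> alg P" for x
  proof -
    have "alg P \<subseteq> {x. q * x - x * q \<in> ?N}"
      unfolding alg_def[of P] using qx[unfolded alg_def]
      by (intro span_minimal subspace_commutator subspace_span) auto
    then show ?thesis using that by auto
  qed
  have "u \<in> {u. q * u \<in> M (Suc d)}" using u
  proof (rule M_induct)
    fix x y z assume *: "x \<in> alg P" "y \<in> fil T d" "z \<in> alg Q"
    have "q * (x * y * z) = (q * x - x * q) * (y * z) + x * (q * y) * z"
      by (simp add: algebra_simps)
    moreover have "(q * x - x * q) * (y * z) \<in> M (Suc d)"
    proof (rule span_mult_left_subspace[OF qx[OF *(1)] subspace_M])
      fix a assume "a \<in> {x * t | x t. x \<in> alg P \<and> t \<in> fil T 1}"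
      then obtain x' t where a: "a = x' * t" "x' \<in> alg P" "t \<in> fil T 1" by blast
      then show "a * (y * z) \<in> M (Suc d)"
        using M_I[OF a(2) _ *(3), of "t * y" "Suc d"] fil_mult[OF a(3) *(2)] by (simp add: mult.assoc)
    qed
    moreover have "x * (q * y) * z \<in> M (Suc d)"
      using M_mult_alg[OF alg_mult_M[OF Q_mult_fil[OF q *(2)] *(1)] *(3)] M_mono[of d "Suc d"] by auto
    ultimately show "x * y * z \<in> {u. q * u \<in> M (Suc d)}" by (simp add: subspace_add)
  qed (simp add: subspace_mult_left_vimage)
  then show ?thesis by simp
qed

text \<open>Jacobi identity: [s, [q, p]] = [[s, q], p] + [q, [s, p]], and both summands are brackets
  of span Q with span P.\<close>

lemma commutator_T_span_T:
  assumes s: "s \<in> T" and t: "t \<in> T"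
  shows "s * t - t * s \<in> span T"
proof -
  obtain q p where qp: "q \<in> Q" "p \<in> P" "t = q * p - p * q" using t by (auto simp: T_def)
  have 1: "a * p - p * a \<in> span T" if "a \<in> span Q" for a
    using that
  proof (induction rule: span_induct_alt)
    case (step c x y)
    have "x * p - p * x \<in> span T" using step(1) qp(2) by (intro span_base) (auto simp: T_def)
    then show ?case using step by (simp add: commutator_linear commutator_linear' span_add span_scale)
  qed (simp add: span_zero)
  have 2: "q * a - a * q \<in> span T" if "a \<in> span P" for a
    using that
  proof (induction rule: span_induct_alt)
    case (step c x y)
    have "q * x - x * q \<in> span T" using step(1) qp(1) by (intro span_base) (auto simp: T_def)
    then show ?case using step by (simp add: commutator_linear commutator_linear' span_add span_scale)
  qed (simp add: span_zero)
  have "s * t - t * s = ((s * q - q * s) * p - p * (s * q - q * s)) + (q * (s * p - p * s) - (s * p - p * s) * q)"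
    by (simp add: qp(3) algebra_simps)
  then show ?thesis using 1[OF TQ[OF s qp(1)]] 2[OF TP[OF s qp(2)]] by (simp add: span_add)
qed

lemma fil_subset_M: "fil T d \<subseteq> M d"
  using M_I[OF one_in_alg _ one_in_alg, of _ d] by auto

section \<open>Reordering powers and collecting equal letters\<close>

lemma commutator_power:
  assumes "q \<in> Q" "p \<in> P" "t = q * p - p * q"
  shows "\<exists>w\<in>alg P. q * p ^ Suc j = p ^ Suc j * q + of_nat (Suc j) *s (p ^ j * t) + w"
proof (induction j)
  case 0
  then show ?case using assms(3) subspace_0[OF subspace_alg] by (intro bexI[of _ 0]) auto
next
  case (Suc j)
  have t: "t \<in> T" using assms by (auto simp: T_def)
  have p: "p \<in> alg P" using assms(2) span_subset_alg span_base by auto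
  obtain w where w: "w \<in> alg P"
    "q * p ^ Suc j = p ^ Suc j * q + of_nat (Suc j) *s (p ^ j * t) + w" using Suc by blast
  let ?w = "p * w + (t * p ^ Suc j - p ^ Suc j * t)"
  have "q * p ^ Suc (Suc j) = t * p ^ Suc j + p * (q * p ^ Suc j)"
    by (simp add: assms(3) algebra_simps)
  also have "\<dots> = p ^ Suc (Suc j) * q + (of_nat (Suc j) + 1) *s (p ^ Suc j * t) + ?w"
    unfolding w(2) scale_left_distrib scale_one
    by (simp add: distrib_left scale_mult_right mult.assoc algebra_simps del: of_nat_Suc)
  finally have "q * p ^ Suc (Suc j) = p ^ Suc (Suc j) * q + of_nat (Suc (Suc j)) *s (p ^ Suc j * t) + ?w"
    by (simp add: add.commute)
  moreover have "?w \<in> alg P"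
    by (intro subspace_add[OF subspace_alg] alg_mult p w commutator_T_alg_P t alg_power)
  ultimately show ?case by blast
qed

text \<open>The induction yields c = (j + 1) * ... * (j + k), which is k! for j = 0 and hence
  invertible in characteristic 0. The surplus exponent \<open>j\<close> is needed because peeling
  off one \<open>q\<close> uses the previous case at j + 1. For k = 0 the remainder must be exactly
  0: an element of \<open>M 0\<close> would land in \<open>M 1\<close> after the next factor
  \<open>q\<close>, one degree too high.\<close>

lemma Q_power_mult_P_power:
  assumes "q \<in> Q" "p \<in> P" "t = q * p - p * q"
  shows "\<exists>c m. c \<noteq> 0 \<and> m \<in> (if k = 0 then {0} else M (k - 1)) \<and>
    q ^ k * p ^ (k + j) = c *s (p ^ j * t ^ k) + m"
proof (induction k arbitrary: j)
  case 0
  then show ?case by (intro exI[of _ 1] exI[of _ 0]) simp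
next
  case (Suc k)
  have t: "t \<in> T" using assms by (auto simp: T_def)
  have p: "p \<in> alg P" using assms(2) span_subset_alg span_base by auto
  have tk: "t ^ k \<in> fil T k" using fil_power[OF span_base[OF t]] .
  obtain c m where cm: "c \<noteq> 0" "m \<in> (if k = 0 then {0} else M (k - 1))"
    "q ^ k * p ^ (k + Suc j) = c *s (p ^ Suc j * t ^ k) + m" using Suc[of "Suc j"] by blast
  obtain w where w: "w \<in> alg P"
    "q * p ^ Suc j = p ^ Suc j * q + of_nat (Suc j) *s (p ^ j * t) + w"
    using commutator_power[OF assms] by blast
  \<comment> \<open>Each part has at most k factors from \<open>T\<close>: crossing t^k costs
    \<open>q\<close> nothing, \<open>w\<close> lies in \<open>alg P\<close>, and \<open>q\<close>
    raises the degree k - 1 of \<open>m\<close> by one.\<close>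
  let ?m = "c *s (p ^ Suc j * (q * t ^ k) + w * t ^ k) + q * m"
  have "q ^ Suc k * p ^ (Suc k + j) = q * (q ^ k * p ^ (k + Suc j))" by (simp add: mult.assoc)
  also have "\<dots> = c *s ((q * p ^ Suc j) * t ^ k) + q * m"
    unfolding cm(3) by (simp add: distrib_left scale_mult_right mult.assoc)
  also have "\<dots> = (c * of_nat (Suc j)) *s (p ^ j * t ^ Suc k) + ?m"
    unfolding w(2)
    by (simp add: distrib_right scale_mult_left scale_right_distrib mult.assoc del: of_nat_Suc)
  finally have "q ^ Suc k * p ^ (Suc k + j) = (c * of_nat (Suc j)) *s (p ^ j * t ^ Suc k) + ?m" .
  moreover have "q * m \<in> M k"
    using cm(2) Q_mult_M[OF assms(1), of m "k - 1"] subspace_0[OF subspace_M] by (cases k) auto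
  then have "?m \<in> M k"
    using subsetD[OF fil_subset_M tk]
    by (intro subspace_add[OF subspace_M] subspace_scale[OF subspace_M]
        alg_mult_M[OF _ alg_power[OF p]] alg_mult_M[OF _ w(1)] Q_mult_fil[OF assms(1) tk])
  moreover have "c * of_nat (Suc j) \<noteq> 0" using cm(1) by (simp del: of_nat_Suc)
  ultimately show ?case by (intro exI[of _ "c * of_nat (Suc j)"] exI[of _ ?m]) simp
qed

text \<open>The error is the commutator of \<open>t\<close> with \<open>us\<close>, followed by
  \<open>vs\<close>; by \<open>commutator_fil\<close> it is one letter shorter than the word
  itself.\<close>

lemma T_move_front:
  assumes "set (us @ t # vs) \<subseteq> T"
  shows "prod_list (us @ t # vs) - t * prod_list (us @ vs) \<in> fil T (length (us @ vs))"
proof -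
  have "(t * prod_list us - prod_list us * t) * prod_list vs \<in> fil T (length us + length vs)"
    using assms commutator_T_span_T by (intro fil_mult commutator_fil prod_list_in_fil) auto
  then have "- ((t * prod_list us - prod_list us * t) * prod_list vs) \<in> fil T (length us + length vs)"
    by (rule subspace_neg[OF subspace_fil])
  then show ?thesis by (simp add: algebra_simps)
qed

lemma T_power_front:
  assumes "set ys \<subseteq> T" "k \<le> count_list ys t"
  shows "\<exists>zs. set zs \<subseteq> T \<and> length zs + k = length ys \<and> count_list zs t + k = count_list ys t \<and>
    prod_list ys - t ^ k * prod_list zs \<in> fil T (length ys - 1)"
  using assms(2)
proof (induction k)
  case 0
  then show ?case using assms subspace_0[OF subspace_fil] by (intro exI[of _ ys]) auto
next
  case (Suc k)
  then obtain zs where zs: "set zs \<subseteq> T" "length zs + k = length ys"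
    "count_list zs t + k = count_list ys t"
    "prod_list ys - t ^ k * prod_list zs \<in> fil T (length ys - 1)" by auto
  have "count_list zs t \<noteq> 0" using Suc.prems zs(3) by linarith
  then have "t \<in> set zs" by (simp add: count_list_0_iff)
  then obtain us vs where uv: "zs = us @ t # vs" using split_list by metis
  have t: "t \<in> T" using uv zs(1) by auto
  have "t ^ k * (prod_list zs - t * prod_list (us @ vs)) \<in> fil T (k + length (us @ vs))"
    using T_move_front[of us t vs] zs(1) uv fil_power[OF span_base[OF t], of k] by (intro fil_mult) auto
  moreover have "k + length (us @ vs) = length ys - 1" using uv zs(2) by simp
  ultimately have "(prod_list ys - t ^ k * prod_list zs) + t ^ k * (prod_list zs - t * prod_list (us @ vs))
     \<in> fil T (length ys - 1)" using zs(4) by (simp only: subspace_add[OF subspace_fil])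
  moreover have "(prod_list ys - t ^ k * prod_list zs) + t ^ k * (prod_list zs - t * prod_list (us @ vs))
    = prod_list ys - t ^ Suc k * prod_list (us @ vs)"
    by (simp add: right_diff_distrib mult.assoc power_Suc2 del: prod_list.append power_Suc)
  ultimately have "prod_list ys - t ^ Suc k * prod_list (us @ vs) \<in> fil T (length ys - 1)" by (simp only:)
  moreover have "set (us @ vs) \<subseteq> T" "length (us @ vs) + Suc k = length ys"
    "count_list (us @ vs) t + Suc k = count_list ys t" using zs uv by auto
  ultimately show ?case by blast
qed

section \<open>Nilpotency bounds the number of middle factors\<close>

context
  fixes l :: nat
  assumes l: "l \<ge> 1" and fin: "finite P" "finite Q"
    and P_nil: "\<And>ps. set ps \<subseteq> P \<Longrightarrow> length ps = l \<Longrightarrow> prod_list ps = 0"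
    and Q_nil: "\<And>qs. set qs \<subseteq> Q \<Longrightarrow> length qs = l \<Longrightarrow> prod_list qs = 0"
begin

lemma T_power: assumes "t \<in> T" shows "t ^ l \<in> M (l - 1)"
proof -
  obtain q p where qp: "q \<in> Q" "p \<in> P" "t = q * p - p * q" using assms by (auto simp: T_def)
  obtain c m where cm: "c \<noteq> 0" "m \<in> M (l - 1)" "q ^ l * p ^ l = c *s (t ^ l) + m"
    using Q_power_mult_P_power[OF qp, of l 0] l by auto
  have "p ^ l = 0" using P_nil[of "replicate l p"] qp(2) by (simp add: prod_list_replicate set_replicate_conv_if)
  then have "c *s (t ^ l) = - m" using cm(3) by (simp add: eq_neg_iff_add_eq_0)
  then have "c *s (t ^ l) \<in> M (l - 1)" using cm(2) subspace_neg[OF subspace_M] by simp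
  then have "inverse c *s (c *s (t ^ l)) \<in> M (l - 1)" by (rule subspace_scale[OF subspace_M])
  then show ?thesis using cm(1) by simp
qed

text \<open>A word longer than card T * (l - 1) contains some letter at least l times. Gathered in
  front, these copies form t^l, which lies in \<open>M (l - 1)\<close>, so at least one
  \<open>T\<close>-factor is saved.\<close>

lemma M_stable: "M (Suc (card T * (l - 1))) \<subseteq> M (card T * (l - 1))"
proof
  let ?d = "card T * (l - 1)"
  have finT: "finite T"
  proof -
    have "T = (\<lambda>(q, p). q * p - p * q) ` (Q \<times> P)" unfolding T_def by auto
    then show ?thesis using fin by simp
  qed
  have y: "y \<in> M ?d" if "y \<in> fil T (Suc ?d)" for y
    using that
  proof (rule fil_induct)
    fix ys assume ys: "set ys \<subseteq> T" "length ys \<le> Suc ?d"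
    show "prod_list ys \<in> M ?d"
    proof (cases "length ys \<le> ?d")
      case True
      then show ?thesis using ys fil_subset_M prod_list_in_fil by blast
    next
      case False
      have "\<exists>t\<in>T. count_list ys t \<ge> l"
      proof (rule ccontr)
        assume "\<not> ?thesis"
        then have "sum (count_list ys) T \<le> sum (\<lambda>_. l - 1) T"
          using l by (intro sum_mono) (fastforce simp: not_le)
        then show False using sum_count_set[OF ys(1) finT] False by simp
      qed
      then obtain t where t: "t \<in> T" "l \<le> count_list ys t" by blast
      obtain zs where zs: "set zs \<subseteq> T" "length zs + l = length ys"
        "prod_list ys - t ^ l * prod_list zs \<in> fil T (length ys - 1)"
        using T_power_front[OF ys(1) t(2)] by blast
      \<comment> \<open>The word has exactly ?d + 1 letters. After the trade l - 1 factors come from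
        t^l and ?d + 1 - l from \<open>zs\<close>, together ?d.\<close>
      have d: "l - 1 + length zs = ?d" "length ys - 1 = ?d" using zs(2) ys(2) False l by linarith+
      have "t ^ l * prod_list zs \<in> M ?d"
        using M_mult_T_word[OF T_power[OF t(1)] zs(1)] d by simp
      moreover have "prod_list ys - t ^ l * prod_list zs \<in> M ?d"
        using zs(3) d fil_subset_M by auto
      ultimately have "(prod_list ys - t ^ l * prod_list zs) + t ^ l * prod_list zs \<in> M ?d"
        by (simp only: subspace_add[OF subspace_M])
      then show ?thesis by simp
    qed
  qed simp
  fix u assume "u \<in> M (Suc ?d)"
  then show "u \<in> M ?d"
    by (rule M_induct) (simp, intro M_mult_alg alg_mult_M y)
qed

lemma alg_subset_fil:
  assumes "\<And>xs. set xs \<subseteq> X \<Longrightarrow> length xs = l \<Longrightarrow> prod_list xs = 0"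
  shows "alg X \<subseteq> fil X l"
  unfolding alg_def
proof (rule span_minimal)
  show "{prod_list xs |xs. set xs \<subseteq> X} \<subseteq> fil X l"
  proof clarify
    fix xs assume xs: "set xs \<subseteq> X"
    show "prod_list xs \<in> fil X l"
    proof (cases "length xs \<le> l")
      case True then show ?thesis using xs prod_list_in_fil by blast
    next
      case False
      have "prod_list xs = prod_list (take l xs) * prod_list (drop l xs)"
        by (metis append_take_drop_id prod_list.append)
      moreover have "prod_list (take l xs) = 0"
        using xs False set_take_subset[of l xs] by (intro assms) auto
      ultimately show ?thesis using subspace_0[OF subspace_fil] by simp
    qed
  qed
qed simp

text \<open>Containing 1 and being stable under left multiplication, \<open>U\<close> contains the
  algebra generated by \<open>P\<close> and \<open>Q\<close>. The one-sided form spares a proof that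
  \<open>M\<close> is closed under products: \<open>P\<close> is absorbed on the left, and the
  degree that \<open>Q\<close> adds is removed by \<open>M_stable\<close>.\<close>

theorem finite_dimensional_left_ideal:
  "\<exists>U B. subspace U \<and> finite B \<and> U \<subseteq> span B \<and> 1 \<in> U \<and> (\<forall>x\<in>P \<union> Q. \<forall>u\<in>U. x * u \<in> U)"
proof -
  let ?d = "card T * (l - 1)"
  let ?W = "\<lambda>X d. {prod_list xs | xs. set xs \<subseteq> X \<and> length xs \<le> d}"
  let ?B = "(\<lambda>(x, y, z). x * y * z) ` (?W P l \<times> ?W T ?d \<times> ?W Q l)"
  have T_eq: "T = (\<lambda>(q, p). q * p - p * q) ` (Q \<times> P)" unfolding T_def by auto
  have W: "finite (?W X d)" if "finite X" for X d
  proof -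
    have "?W X d = prod_list ` {xs. set xs \<subseteq> X \<and> length xs \<le> d}" by auto
    then show ?thesis using finite_lists_length_le[OF that] by simp
  qed
  have "finite T" unfolding T_eq using fin by simp
  then have B: "finite ?B" using W fin by (intro finite_imageI finite_cartesian_product)
  have "M ?d \<subseteq> span ?B"
    unfolding M_def
  proof (rule span_minimal)
    show "{x * y * z |x y z. x \<in> alg P \<and> y \<in> fil T ?d \<and> z \<in> alg Q} \<subseteq> span ?B"
    proof clarify
      fix x y z assume "x \<in> alg P" "y \<in> fil T ?d" "z \<in> alg Q"
      then have "x \<in> span (?W P l)" "y \<in> span (?W T ?d)" "z \<in> span (?W Q l)"
        using alg_subset_fil[OF P_nil] alg_subset_fil[OF Q_nil] by (auto simp: fil_def)
      moreover from this(1,2) have "x * y \<in> span {a * b | a b. a \<in> ?W P l \<and> b \<in> ?W T ?d}"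
        by (rule span_mult_subspace) (auto intro!: span_base)
      moreover have "u * w \<in> span ?B"
        if "u \<in> {a * b | a b. a \<in> ?W P l \<and> b \<in> ?W T ?d}" "w \<in> ?W Q l" for u w
      proof -
        from that(1) obtain a b where ab: "u = a * b" "a \<in> ?W P l" "b \<in> ?W T ?d" by blast
        then have "(\<lambda>(x, y, z). x * y * z) (a, b, w) \<in> ?B" using that(2) by (intro imageI) blast
        then show ?thesis using ab(1) by (simp add: span_base)
      qed
      ultimately show "x * y * z \<in> span ?B"
        by (intro span_mult_subspace[of "x * y" _ z "?W Q l" "span ?B"] subspace_span)
    qed
  qed simp
  moreover have "x * u \<in> M ?d" if "x \<in> P \<union> Q" "u \<in> M ?d" for x u
  proof (cases "x \<in> P")
    case True
    then show ?thesis using that span_subset_alg span_base by (auto intro!: alg_mult_M)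
  next
    case False
    then show ?thesis using that Q_mult_M M_stable by blast
  qed
  ultimately show ?thesis using B one_in_M by (intro exI[of _ "M ?d"] exI[of _ ?B]) auto
qed

end

end

section \<open>Words alternating in every second letter\<close>

context complex_algebra
begin

text \<open>Modulo shorter words a b c = - c b a, so the first \<open>a\<close> hops over two
  letters at a time. The gap is odd, hence it shrinks to a single letter, where the relation reads 2
  a b a = 0 modulo shorter words.\<close>

lemma repeated_letter_in_fil:
  assumes rel: "\<And>a b c. a \<in> X \<Longrightarrow> b \<in> X \<Longrightarrow> c \<in> X \<Longrightarrow> a * b * c + c * b * a \<in> fil X 2"
    and "length vs = 2 * k + 1" "set vs \<subseteq> X" "a \<in> X"
  shows "a * prod_list vs * a \<in> fil X (length vs + 1)"
  using assms(2,3)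
proof (induction k arbitrary: vs)
  case 0
  then obtain b where vs: "vs = [b]" "b \<in> X" by (cases vs) auto
  have "inverse 2 *s (a * b * a + a * b * a) \<in> fil X 2"
    using rel[OF assms(4) vs(2) assms(4)] by (rule subspace_scale[OF subspace_fil])
  moreover have "x + x = 2 *s x" for x
    using scale_left_distrib[of 1 1 x] by simp
  ultimately show ?case using vs by (simp add: numeral_2_eq_2)
next
  case (Suc k)
  then obtain b c ws where vs: "vs = b # c # ws" "b \<in> X" "c \<in> X" "set ws \<subseteq> X" "length ws = 2 * k + 1"
    by (cases vs; cases "tl vs") auto
  have "(a * b * c + c * b * a) * (prod_list (ws @ [a])) \<in> fil X (2 + (length ws + 1))"
    using vs assms(4) by (intro fil_mult rel prod_list_in_fil) auto
  moreover have "prod_list [c, b] * (a * prod_list ws * a) \<in> fil X (2 + (length ws + 1))"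
    using fil_mult[OF prod_list_in_fil[of "[c, b]" X 2] Suc.IH[OF vs(5,4)]] vs by simp
  ultimately have "(a * b * c + c * b * a) * (prod_list (ws @ [a])) - prod_list [c, b] * (a * prod_list ws * a)
    \<in> fil X (2 + (length ws + 1))" by (rule subspace_diff[OF subspace_fil])
  then show ?case using vs by (simp add: algebra_simps)
qed

theorem finite_dimensional_left_ideal_of_alternating:
  assumes fin: "finite X"
    and rel: "\<And>a b c. a \<in> X \<Longrightarrow> b \<in> X \<Longrightarrow> c \<in> X \<Longrightarrow> a * b * c + c * b * a \<in> fil X 2"
  shows "\<exists>U B. subspace U \<and> finite B \<and> U \<subseteq> span B \<and> 1 \<in> U \<and> (\<forall>x\<in>X. \<forall>u\<in>U. x * u \<in> U)"
proof -
  \<comment> \<open>A word of ?d + 1 letters has card X + 1 letters at the indices 0, 2, ..., ?d, so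
    two of them agree and the gap between them is odd.\<close>
  let ?d = "2 * card X"
  have long: "prod_list xs \<in> fil X ?d" if xs: "set xs \<subseteq> X" "length xs = Suc ?d" for xs
  proof -
    let ?f = "\<lambda>i. xs ! (2 * i)"
    have "?f ` {..card X} \<subseteq> X" using xs by (auto simp: subset_iff)
    then have "\<not> inj_on ?f {..card X}"
      using card_inj_on_le[of ?f "{..card X}" X] fin by auto
    then obtain i j where ij: "i < j" "j \<le> card X" "?f i = ?f j"
      by (auto simp: inj_on_def) (metis linorder_neqE_nat)
    let ?a = "?f i" and ?us = "take (2 * i) xs" and ?ws = "drop (Suc (2 * j)) xs"
    let ?vs = "take (2 * j - Suc (2 * i)) (drop (Suc (2 * i)) xs)"
    have "xs = ?us @ ?a # drop (Suc (2 * i)) xs"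
      using ij xs by (intro id_take_nth_drop) simp
    moreover have "drop (Suc (2 * i)) xs = ?vs @ ?a # ?ws"
    proof -
      have "drop (Suc (2 * i)) xs = ?vs @ (drop (Suc (2 * i)) xs ! (2 * j - Suc (2 * i)))
        # drop (Suc (2 * j - Suc (2 * i))) (drop (Suc (2 * i)) xs)"
        using ij xs by (intro id_take_nth_drop) simp
      then show ?thesis using ij xs by simp
    qed
    ultimately have eq: "xs = ?us @ ?a # ?vs @ ?a # ?ws" by simp
    have len: "length ?vs = 2 * (j - i - 1) + 1" using ij xs by simp
    have sub: "set ?us \<subseteq> X" "set ?vs \<subseteq> X" "set ?ws \<subseteq> X" "?a \<in> X"
      using xs ij by (auto dest!: in_set_takeD in_set_dropD)
    have "prod_list ?us * (?a * prod_list ?vs * ?a) * prod_list ?ws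
      \<in> fil X (length ?us + (length ?vs + 1) + length ?ws)"
      by (rule fil_mult[OF fil_mult[OF _ repeated_letter_in_fil[OF rel len sub(2,4)]]])
        (use sub in \<open>simp_all add: prod_list_in_fil\<close>)
    moreover have "length ?us + (length ?vs + 1) + length ?ws = ?d" using ij xs by simp
    moreover have "prod_list xs = prod_list ?us * (?a * prod_list ?vs * ?a) * prod_list ?ws"
      by (subst eq) (simp add: mult.assoc)
    ultimately show ?thesis by simp
  qed
  have "x * u \<in> fil X ?d" if x: "x \<in> X" and u: "u \<in> fil X ?d" for x u
  proof -
    have "u \<in> {u. x * u \<in> fil X ?d}" using u
    proof (rule fil_induct)
      fix xs assume xs: "set xs \<subseteq> X" "length xs \<le> ?d"
      show "prod_list xs \<in> {u. x * u \<in> fil X ?d}"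
        using long[of "x # xs"] prod_list_in_fil[of "x # xs" X ?d] x xs
        by (cases "length xs = ?d") auto
    qed (simp add: subspace_mult_left_vimage)
    then show ?thesis by simp
  qed
  moreover have "finite {prod_list xs | xs. set xs \<subseteq> X \<and> length xs \<le> ?d}"
  proof -
    have "{prod_list xs | xs. set xs \<subseteq> X \<and> length xs \<le> ?d}
      = prod_list ` {xs. set xs \<subseteq> X \<and> length xs \<le> ?d}" by auto
    then show ?thesis using finite_lists_length_le[OF fin] by simp
  qed
  ultimately show ?thesis
    using one_in_fil[of X ?d] subspace_fil[of X ?d] unfolding fil_def by blast
qed

end

section \<open>Families of matrices\<close>

text \<open>The product of full matrix rings over all indices. The first component of an index is
  the dimension, the second carries the data of the representation, so representations of all
  dimensions fit into one ring, however many they are.\<close>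

typedef 's mat_family =
  "{M :: nat \<times> 's \<Rightarrow> cm. \<forall>r. M r \<in> carrier_mat (fst r) (fst r)}"
  morphisms mat_at Abs_family
  by (rule exI[of _ "\<lambda>r. 0\<^sub>m (fst r) (fst r)"]) simp

definition family :: "(nat \<times> 's \<Rightarrow> cm) \<Rightarrow> 's mat_family" where
  "family M = Abs_family (\<lambda>r. if M r \<in> carrier_mat (fst r) (fst r) then M r else 0\<^sub>m (fst r) (fst r))"

lemma mat_at_carrier [simp]: "mat_at x r \<in> carrier_mat (fst r) (fst r)"
  using mat_at[of x] by blast

lemma dim_mat_at [simp]: "dim_row (mat_at x r) = fst r" "dim_col (mat_at x r) = fst r"
  using mat_at_carrier[of x r] by (auto simp del: mat_at_carrier)

lemma mat_at_family: "M r \<in> carrier_mat (fst r) (fst r) \<Longrightarrow> mat_at (family M) r = M r"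
  unfolding family_def by (subst Abs_family_inverse) auto

lemma mat_family_eqI: "(\<And>r. mat_at x r = mat_at y r) \<Longrightarrow> x = y"
  using mat_at_inject[of x y] by blast

instantiation mat_family :: (type) ring_1
begin

definition "0 = family (\<lambda>r. 0\<^sub>m (fst r) (fst r))"
definition "1 = family (\<lambda>r. 1\<^sub>m (fst r))"
definition "x + y = family (\<lambda>r. mat_at x r + mat_at y r)"
definition "x - y = family (\<lambda>r. mat_at x r - mat_at y r)"
definition "- x = family (\<lambda>r. - mat_at x r)"
definition "x * y = family (\<lambda>r. mat_at x r * mat_at y r)"

lemma mat_at_ops:
  "mat_at 0 r = 0\<^sub>m (fst r) (fst r)"
  "mat_at 1 r = 1\<^sub>m (fst r)"
  "mat_at (x + y) r = mat_at x r + mat_at y r"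
  "mat_at (x - y) r = mat_at x r - mat_at y r"
  "mat_at (- x) r = - mat_at x r"
  "mat_at (x * y) r = mat_at x r * mat_at y r"
  by (simp_all add: zero_mat_family_def one_mat_family_def plus_mat_family_def minus_mat_family_def
      uminus_mat_family_def times_mat_family_def mat_at_family
      minus_carrier_mat[OF mat_at_carrier] mult_carrier_mat[OF mat_at_carrier mat_at_carrier])

instance
proof
  fix x y z :: "'a mat_family"
  show "x + y + z = x + (y + z)" "x + y = y + x" "0 + x = x" "- x + x = 0" "x - y = x + - y"
    by (rule mat_family_eqI; simp add: mat_at_ops; rule eq_matI; simp)+
  show "x * y * z = x * (y * z)"
    by (rule mat_family_eqI) (simp add: mat_at_ops assoc_mult_mat[OF mat_at_carrier mat_at_carrier mat_at_carrier])
  show "1 * x = x" "x * 1 = x"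
    by (rule mat_family_eqI, simp add: mat_at_ops left_mult_one_mat[OF mat_at_carrier] right_mult_one_mat[OF mat_at_carrier])+
  show "(x + y) * z = x * z + y * z" "x * (y + z) = x * y + x * z"
    by (rule mat_family_eqI, simp add: mat_at_ops add_mult_distrib_mat[OF mat_at_carrier mat_at_carrier mat_at_carrier]
      mult_add_distrib_mat[OF mat_at_carrier mat_at_carrier mat_at_carrier])+
  show "(0 :: 'a mat_family) \<noteq> 1"
  proof
    assume "(0 :: 'a mat_family) = 1"
    \<comment> \<open>An index of positive dimension is required: for 0 x 0 matrices zero and one
      coincide.\<close>
    then have "mat_at (0 :: 'a mat_family) (1, undefined) = mat_at 1 (1, undefined)" by simp
    then have "(0\<^sub>m 1 1 :: cm) $$ (0, 0) = 1\<^sub>m 1 $$ (0, 0)" by (simp add: mat_at_ops)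
    then show False by simp
  qed
qed

end

definition fam_scale :: "complex \<Rightarrow> 's mat_family \<Rightarrow> 's mat_family" where
  "fam_scale c x = family (\<lambda>r. c \<cdot>\<^sub>m mat_at x r)"

lemma mat_at_scale: "mat_at (fam_scale c x) r = c \<cdot>\<^sub>m mat_at x r"
  by (simp add: fam_scale_def mat_at_family)

interpretation fam: complex_algebra fam_scale
proof
  fix a b :: complex and x y :: "'a mat_family"
  show "fam_scale a (x + y) = fam_scale a x + fam_scale a y"
    "fam_scale (a + b) x = fam_scale a x + fam_scale b x"
    "fam_scale a (fam_scale b x) = fam_scale (a * b) x"
    "fam_scale 1 x = x"
    by (rule mat_family_eqI; simp add: mat_at_ops mat_at_scale; rule eq_matI; simp add: algebra_simps)+
  show "fam_scale a x * y = fam_scale a (x * y)" "x * fam_scale a y = fam_scale a (x * y)"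
    by (rule mat_family_eqI, simp add: mat_at_ops mat_at_scale mult_smult_assoc_mat[OF mat_at_carrier mat_at_carrier]
      mult_smult_distrib[OF mat_at_carrier mat_at_carrier])+
qed

section \<open>Separating irreducible representations by evaluation on one vector\<close>

definition base_vec :: "nat \<times> 's \<Rightarrow> cv" where
  "base_vec r = unit_vec (fst r) 0"

text \<open>For fixed \<open>r\<close> this is a homomorphism of left modules from the ring of
  families to the space of \<open>r\<close>. Any nonzero vector would serve in place of the first
  unit vector, since each one generates an irreducible module.\<close>

definition act :: "'s mat_family \<Rightarrow> nat \<times> 's \<Rightarrow> cv" where
  "act u r = mat_at u r *\<^sub>v base_vec r"

lemma base_vec_carrier [simp]: "base_vec r \<in> carrier_vec (fst r)"
  by (simp add: base_vec_def)

lemma act_carrier [simp]: "act u r \<in> carrier_vec (fst r)"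
  unfolding act_def by (rule mult_mat_vec_carrier[OF mat_at_carrier base_vec_carrier])

lemma dim_act [simp]: "dim_vec (act u r) = fst r"
  by (rule carrier_vecD) simp

lemma act_ops:
  "act 0 r = 0\<^sub>v (fst r)"
  "act (u + v) r = act u r + act v r"
  "act (u - v) r = act u r - act v r"
  "act (fam_scale c u) r = c \<cdot>\<^sub>v act u r"
  "act (x * u) r = mat_at x r *\<^sub>v act u r"
proof -
  have "(c \<cdot>\<^sub>m A) *\<^sub>v v = c \<cdot>\<^sub>v (A *\<^sub>v v)" if "A \<in> carrier_mat n n" "v \<in> carrier_vec n"
    for A :: cm and v n
    using that by (intro eq_vecI) (auto simp: scalar_prod_def sum_distrib_left mult.assoc)
  note * = this[OF mat_at_carrier base_vec_carrier]
  have **: "0\<^sub>m n n *\<^sub>v v = 0\<^sub>v n" if "v \<in> carrier_vec n" for v :: cv and n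
    using that by (intro eq_vecI) auto
  show
    "act 0 r = 0\<^sub>v (fst r)"
    "act (u + v) r = act u r + act v r"
    "act (u - v) r = act u r - act v r"
    "act (fam_scale c u) r = c \<cdot>\<^sub>v act u r"
    "act (x * u) r = mat_at x r *\<^sub>v act u r"
  unfolding act_def
  by (simp_all add: * **[OF base_vec_carrier] mat_at_ops mat_at_scale add_mult_distrib_mat_vec[OF mat_at_carrier mat_at_carrier]
      minus_mult_distrib_mat_vec[OF mat_at_carrier mat_at_carrier] assoc_mult_mat_vec[OF mat_at_carrier mat_at_carrier])
qed

lemma invertible_matI:
  "F \<in> carrier_mat n n \<Longrightarrow> G \<in> carrier_mat n n \<Longrightarrow> F * G = 1\<^sub>m n \<Longrightarrow> G * F = 1\<^sub>m n \<Longrightarrow> invertible_mat F"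
  by (auto simp: invertible_mat_def inverts_mat_def)

text \<open>Common form of \<open>gen_equiv\<close> and \<open>rep_equiv\<close>, with the elements
  of \<open>X\<close> as the images of generators.\<close>

definition intertwined :: "'s mat_family set \<Rightarrow> nat \<times> 's \<Rightarrow> nat \<times> 's \<Rightarrow> bool" where
  "intertwined X r s \<longleftrightarrow> fst r = fst s \<and>
     (\<exists>F\<in>carrier_mat (fst r) (fst r). invertible_mat F \<and> (\<forall>x\<in>X. F * mat_at x r = mat_at x s * F))"

lemma intertwined_refl: "intertwined X r r"
proof -
  have "invertible_mat (1\<^sub>m (fst r) :: cm)" by (rule invertible_matI[of _ "fst r" "1\<^sub>m (fst r)"]) simp_all
  moreover have "1\<^sub>m (fst r) * mat_at x r = mat_at x r * 1\<^sub>m (fst r)" for x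
    by (simp add: left_mult_one_mat[OF mat_at_carrier] right_mult_one_mat[OF mat_at_carrier])
  ultimately show ?thesis unfolding intertwined_def by (blast intro: one_carrier_mat)
qed

lemma intertwined_sym: assumes "intertwined X r s" shows "intertwined X s r"
proof -
  let ?n = "fst r"
  have n: "fst s = ?n" using assms by (simp add: intertwined_def)
  obtain F where F: "F \<in> carrier_mat ?n ?n" "invertible_mat F" "\<And>x. x \<in> X \<Longrightarrow> F * mat_at x r = mat_at x s * F"
    using assms unfolding intertwined_def by blast
  obtain G where G: "F * G = 1\<^sub>m ?n" "G * F = 1\<^sub>m (dim_row G)"
    using F(1,2) by (auto simp: invertible_mat_def inverts_mat_def)
  \<comment> \<open>\<open>invertible_mat\<close> leaves the shape of the inverse open; it is read
    off from the two products.\<close>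
  have "dim_col G = ?n" using G(1) by (metis index_mult_mat(3) index_one_mat(3))
  moreover have "dim_row G = ?n" using G(2) F(1) by (metis carrier_matD(2) index_mult_mat(3) index_one_mat(3))
  ultimately have Gc: "G \<in> carrier_mat ?n ?n" by auto
  have "G * mat_at x s = mat_at x r * G" if "x \<in> X" for x
  proof -
    have c: "mat_at x s \<in> carrier_mat ?n ?n" "mat_at x r \<in> carrier_mat ?n ?n"
      using mat_at_carrier[of x s] mat_at_carrier[of x r] n by auto
    have "G * mat_at x s = G * (mat_at x s * (F * G))" using G(1) right_mult_one_mat[OF c(1)] by simp
    also have "\<dots> = G * ((mat_at x s * F) * G)" using c F(1) Gc by (simp add: assoc_mult_mat[of _ ?n ?n _ ?n _ ?n])
    also have "\<dots> = G * ((F * mat_at x r) * G)" using F(3) that by simp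
    also have "\<dots> = (G * F) * (mat_at x r * G)"
      using c F(1) Gc mult_carrier_mat[OF c(2) Gc] by (simp add: assoc_mult_mat[of _ ?n ?n _ ?n _ ?n])
    finally show ?thesis using G Gc c by simp
  qed
  moreover have "invertible_mat G" using G Gc F(1) by (intro invertible_matI[of G ?n F]) auto
  ultimately show ?thesis using Gc n by (auto simp: intertwined_def)
qed

lemma mat_eq_by_mult_vec:
  fixes A B :: cm
  assumes "A \<in> carrier_mat k n" "B \<in> carrier_mat k n"
    and "\<And>v. v \<in> carrier_vec n \<Longrightarrow> A *\<^sub>v v = B *\<^sub>v v"
  shows "A = B"
proof (rule eq_matI)
  fix i j assume ij: "i < dim_row B" "j < dim_col B"
  then have "(A *\<^sub>v unit_vec n j) $ i = (B *\<^sub>v unit_vec n j) $ i" using assms by simp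
  then show "A $$ (i, j) = B $$ (i, j)" using ij assms(1,2) by simp
qed (use assms in auto)

text \<open>Compare the traces of F G and G F; in characteristic 0 the trace of an identity matrix
  determines its size.\<close>

lemma two_sided_inverse_square:
  fixes F G :: cm
  assumes F: "F \<in> carrier_mat k n" and G: "G \<in> carrier_mat n k"
    and FG: "F * G = 1\<^sub>m k" and GF: "G * F = 1\<^sub>m n"
  shows "k = n"
proof -
  have "(of_nat k :: complex) = (\<Sum>i<k. (F * G) $$ (i, i))" using FG by simp
  also have "\<dots> = (\<Sum>i<k. \<Sum>j<n. F $$ (i, j) * G $$ (j, i))"
    using F G by (auto simp: scalar_prod_def lessThan_atLeast0)
  also have "\<dots> = (\<Sum>j<n. \<Sum>i<k. G $$ (j, i) * F $$ (i, j))"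
    by (subst sum.swap) (simp add: mult.commute)
  also have "\<dots> = (\<Sum>j<n. (G * F) $$ (j, j))"
    using F G by (auto simp: scalar_prod_def lessThan_atLeast0)
  also have "\<dots> = of_nat n" using GF by simp
  finally show ?thesis by simp
qed

text \<open>Not an ideal of the whole ring: stability is asked for \<open>X\<close> only, so
  \<open>J\<close> is a left module over the algebra that \<open>X\<close> generates.\<close>

definition left_ideal :: "'s mat_family set \<Rightarrow> 's mat_family set \<Rightarrow> bool" where
  "left_ideal X J \<longleftrightarrow> fam.subspace J \<and> (\<forall>x\<in>X. \<forall>u\<in>J. x * u \<in> J)"

lemma left_ideal_annihilator:
  assumes "left_ideal X J" shows "left_ideal X {u \<in> J. \<forall>s\<in>S. act u s = 0\<^sub>v (fst s)}"
proof -
  have "A *\<^sub>v 0\<^sub>v n = 0\<^sub>v n" if "A \<in> carrier_mat n n" for A :: cm and n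
    using that by (intro eq_vecI) auto
  then show ?thesis
    using assms unfolding left_ideal_def fam.subspace_def by (auto simp: act_ops)
qed

text \<open>The image of a submodule under the module homomorphism \<open>act\<close> at
  \<open>r\<close> is an invariant subspace.\<close>

lemma orbit_trivial:
  assumes J: "left_ideal X J" and irr: "irreducible_fam (fst r) ((\<lambda>x. mat_at x r) ` X)"
  shows "(\<lambda>u. act u r) ` J = {0\<^sub>v (fst r)} \<or> (\<lambda>u. act u r) ` J = carrier_vec (fst r)"
proof -
  have "csubspace (fst r) ((\<lambda>u. act u r) ` J)"
    using J unfolding csubspace_def left_ideal_def fam.subspace_def
    by (auto simp: image_iff) (metis act_ops)+
  moreover have "mat_at x r *\<^sub>v w \<in> (\<lambda>u. act u r) ` J" if "x \<in> X" "w \<in> (\<lambda>u. act u r) ` J" for x w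
    using that J by (auto simp: left_ideal_def act_ops(5)[symmetric])
  ultimately show ?thesis using irr unfolding irreducible_fam_def by blast
qed

lemma act_sum: "finite A \<Longrightarrow> i < fst r \<Longrightarrow>
   act (\<Sum>j\<in>A. fam_scale (c j) (f j)) r $ i = (\<Sum>j\<in>A. c j * act (f j) r $ i)"
  by (induction A rule: finite_induct) (simp_all add: act_ops)

text \<open>On \<open>J\<close> the kernel of evaluation at \<open>t\<close> is contained in the
  kernel at \<open>r\<close>, so evaluation at \<open>r\<close> factors through evaluation at
  \<open>t\<close>. The columns of the factor are the values at \<open>r\<close> of preimages of the
  unit vectors.\<close>

lemma annihilator_map:
  assumes J: "left_ideal X J" and onto: "(\<lambda>u. act u t) ` J = carrier_vec (fst t)"
    and ann: "\<And>u. u \<in> J \<Longrightarrow> act u t = 0\<^sub>v (fst t) \<Longrightarrow> act u r = 0\<^sub>v (fst r)"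
  shows "\<exists>F\<in>carrier_mat (fst r) (fst t). \<forall>u\<in>J. F *\<^sub>v act u t = act u r"
proof -
  have "\<exists>u. u \<in> J \<and> act u t = unit_vec (fst t) j" for j
    using onto unit_vec_carrier[of "fst t" j] by (metis (no_types, lifting) imageE)
  then obtain b where b: "\<And>j. b j \<in> J" "\<And>j. act (b j) t = unit_vec (fst t) j" by metis
  let ?F = "mat (fst r) (fst t) (\<lambda>(i, j). act (b j) r $ i)"
  have "?F *\<^sub>v act u t = act u r" if u: "u \<in> J" for u
  proof -
    \<comment> \<open>This element of \<open>J\<close> has the same value at \<open>t\<close> as
      \<open>u\<close>, so the difference is killed at \<open>t\<close> and, by \<open>ann\<close>,
      also at \<open>r\<close>.\<close>
    let ?v = "\<Sum>j<fst t. fam_scale (act u t $ j) (b j)"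
    have "?v \<in> J" using J b
      by (auto simp: left_ideal_def intro!: fam.subspace_sum fam.subspace_scale)
    then have "u - ?v \<in> J" using J u by (auto simp: left_ideal_def fam.subspace_diff)
    moreover have "act (u - ?v) t = 0\<^sub>v (fst t)"
    proof (rule eq_vecI)
      fix i assume i: "i < dim_vec (0\<^sub>v (fst t) :: cv)"
      have "(\<Sum>j<fst t. act u t $ j * act (b j) t $ i) = (\<Sum>j<fst t. if j = i then act u t $ i else 0)"
        using i by (intro sum.cong) (auto simp: b(2))
      then show "act (u - ?v) t $ i = 0\<^sub>v (fst t) $ i"
        using i by (simp add: act_ops act_sum)
    qed simp
    ultimately have *: "act (u - ?v) r = 0\<^sub>v (fst r)" by (rule ann)
    show ?thesis
    proof (rule eq_vecI)
      fix i assume "i < dim_vec (act u r)"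
      then have i: "i < fst r" by simp
      then have "act u r $ i - act ?v r $ i = 0"
        using arg_cong[OF *, of "\<lambda>w. w $ i"] by (simp add: act_ops)
      then show "(?F *\<^sub>v act u t) $ i = act u r $ i"
        using i by (simp add: act_sum scalar_prod_def lessThan_atLeast0 mult.commute)
    qed simp
  qed
  then show ?thesis by (intro bexI[of _ ?F]) auto
qed

text \<open>Both spaces are the quotient of \<open>J\<close> by the same kernel. The two factor maps
  are mutually inverse, and they commute with \<open>X\<close> because \<open>J\<close> is stable
  under it.\<close>

lemma intertwined_if_same_annihilator:
  fixes X J :: "'s mat_family set"
  assumes J: "left_ideal X J" and t: "(\<lambda>u. act u t) ` J = carrier_vec (fst t)"
    and r: "(\<lambda>u. act u r) ` J = carrier_vec (fst r)"
    and ann: "\<And>u. u \<in> J \<Longrightarrow> act u t = 0\<^sub>v (fst t) \<longleftrightarrow> act u r = 0\<^sub>v (fst r)"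
  shows "intertwined X t r"
proof -
  obtain F where F: "F \<in> carrier_mat (fst r) (fst t)" "\<And>u. u \<in> J \<Longrightarrow> F *\<^sub>v act u t = act u r"
    using annihilator_map[OF J t] ann by blast
  obtain G where G: "G \<in> carrier_mat (fst t) (fst r)" "\<And>u. u \<in> J \<Longrightarrow> G *\<^sub>v act u r = act u t"
    using annihilator_map[OF J r] ann by blast
  have FG: "F * G = 1\<^sub>m (fst r)"
  proof (rule mat_eq_by_mult_vec)
    fix v :: cv assume v: "v \<in> carrier_vec (fst r)"
    then obtain u where "u \<in> J" "v = act u r" using r by auto
    then show "(F * G) *\<^sub>v v = 1\<^sub>m (fst r) *\<^sub>v v"
      using F G v by (simp add: assoc_mult_mat_vec[OF F(1) G(1)])
  qed (use F G in auto)
  have GF: "G * F = 1\<^sub>m (fst t)"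
  proof (rule mat_eq_by_mult_vec)
    fix v :: cv assume v: "v \<in> carrier_vec (fst t)"
    then obtain u where "u \<in> J" "v = act u t" using t by auto
    then show "(G * F) *\<^sub>v v = 1\<^sub>m (fst t) *\<^sub>v v"
      using F G v by (simp add: assoc_mult_mat_vec[OF G(1) F(1)])
  qed (use F G in auto)
  have n: "fst r = fst t" by (rule two_sided_inverse_square[OF F(1) G(1) FG GF])
  have "invertible_mat F" using F(1) G(1) FG GF n by (intro invertible_matI[of F "fst t" G]) auto
  moreover have "F * mat_at x t = mat_at x r * F" if x: "x \<in> X" for x
  proof (rule mat_eq_by_mult_vec)
    show "F * mat_at x t \<in> carrier_mat (fst r) (fst t)" "mat_at x r * F \<in> carrier_mat (fst r) (fst t)"
      using mult_carrier_mat[OF F(1) mat_at_carrier] mult_carrier_mat[OF mat_at_carrier F(1)] by auto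
    fix v :: cv assume v: "v \<in> carrier_vec (fst t)"
    then obtain u where u: "u \<in> J" "v = act u t" using t by auto
    have xu: "x * u \<in> J" using J x u by (auto simp: left_ideal_def)
    have "(F * mat_at x t) *\<^sub>v v = F *\<^sub>v act (x * u) t"
      using v u by (simp add: assoc_mult_mat_vec[OF F(1) mat_at_carrier] act_ops)
    also have "\<dots> = mat_at x r *\<^sub>v (F *\<^sub>v v)" using F(2)[OF xu] F(2)[OF u(1)] u(2) by (simp add: act_ops)
    also have "\<dots> = (mat_at x r * F) *\<^sub>v v" using v by (simp add: assoc_mult_mat_vec[OF mat_at_carrier F(1)])
    finally show "(F * mat_at x t) *\<^sub>v v = (mat_at x r * F) *\<^sub>v v" .
  qed
  ultimately show ?thesis using F(1) n by (auto simp: intertwined_def)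
qed

text \<open>Induction on \<open>S\<close>. If everything in the submodule ?J killed at
  \<open>S\<close> that dies at \<open>t\<close> also died at \<open>r\<close>, irreducibility would
  force the two kernels on ?J to coincide, and \<open>t\<close> and \<open>r\<close> would be
  equivalent.\<close>

lemma separating_element:
  assumes U: "left_ideal X U" "1 \<in> U" and fin: "finite S"
    and irr: "\<And>s. s \<in> insert r S \<Longrightarrow> irreducible_fam (fst s) ((\<lambda>x. mat_at x s) ` X)"
    and non: "\<And>s. s \<in> S \<Longrightarrow> \<not> intertwined X s r"
  shows "\<exists>u\<in>U. (\<forall>s\<in>S. act u s = 0\<^sub>v (fst s)) \<and> act u r \<noteq> 0\<^sub>v (fst r)"
  using fin irr non
proof (induction S rule: finite_induct)
  case empty
  then have "fst r > 0" by (auto simp: irreducible_fam_def)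
  then have "act 1 r \<noteq> 0\<^sub>v (fst r)" by (simp add: act_def mat_at_ops base_vec_def)
  then show ?case using U by auto
next
  case (insert t S)
  let ?J = "{u \<in> U. \<forall>s\<in>S. act u s = 0\<^sub>v (fst s)}"
  have J: "left_ideal X ?J" by (rule left_ideal_annihilator[OF U(1)])
  obtain u0 where u0: "u0 \<in> ?J" "act u0 r \<noteq> 0\<^sub>v (fst r)" using insert by auto
  have Jr: "(\<lambda>u. act u r) ` ?J = carrier_vec (fst r)"
    using orbit_trivial[OF J, of r] insert.prems(1)[of r] u0 by blast
  show ?case
  proof (rule ccontr)
    assume neg: "\<not> ?case"
    then have ann: "act u r = 0\<^sub>v (fst r)" if "u \<in> ?J" "act u t = 0\<^sub>v (fst t)" for u
      using that by auto
    have Jt: "(\<lambda>u. act u t) ` ?J = carrier_vec (fst t)"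
      using orbit_trivial[OF J, of t] insert.prems(1)[of t] u0 ann by blast
    \<comment> \<open>The image of ?K at \<open>t\<close> is zero or everything. In the second case
      some k in ?K agrees with u0 at \<open>t\<close>, so u0 - k dies at \<open>t\<close> and hence
      at \<open>r\<close>; as k dies at \<open>r\<close>, so does u0, a contradiction.\<close>
    let ?K = "{u \<in> ?J. \<forall>s\<in>{r}. act u s = 0\<^sub>v (fst s)}"
    have K: "left_ideal X ?K" by (rule left_ideal_annihilator[OF J])
    have "(\<lambda>u. act u t) ` ?K \<noteq> carrier_vec (fst t)"
    proof
      assume "(\<lambda>u. act u t) ` ?K = carrier_vec (fst t)"
      then obtain k where k: "k \<in> ?K" "act k t = act u0 t" by (metis (no_types, lifting) act_carrier imageE)
      have "u0 - k \<in> ?J" using J u0(1) k(1) fam.subspace_diff by (auto simp: left_ideal_def act_ops)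
      then have "act (u0 - k) r = 0\<^sub>v (fst r)" by (rule ann) (simp add: act_ops k(2))
      then have "act u0 r = 0\<^sub>v (fst r)" using k(1) by (simp add: act_ops)
      then show False using u0(2) by simp
    qed
    then have "(\<lambda>u. act u t) ` ?K = {0\<^sub>v (fst t)}"
      using orbit_trivial[OF K, of t] insert.prems(1)[of t] by blast
    then have "act u t = 0\<^sub>v (fst t)" if "u \<in> ?J" "act u r = 0\<^sub>v (fst r)" for u
      using that by blast
    then have "intertwined X t r"
      using ann by (intro intertwined_if_same_annihilator[OF J Jt Jr]) blast
    then show False using insert.prems(2)[of t] by simp
  qed
qed

text \<open>The separating elements behave like a dual system: all but \<open>f r\<close> are killed
  at \<open>r\<close>, so \<open>f r\<close> is outside the span of the others.\<close>

lemma card_pairwise_inequivalent: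
  assumes U: "left_ideal X U" "1 \<in> U" and B: "finite B" "U \<subseteq> fam.span B" and R: "finite R"
    and irr: "\<And>r. r \<in> R \<Longrightarrow> irreducible_fam (fst r) ((\<lambda>x. mat_at x r) ` X)"
    and non: "\<And>r s. r \<in> R \<Longrightarrow> s \<in> R \<Longrightarrow> r \<noteq> s \<Longrightarrow> \<not> intertwined X s r"
  shows "card R \<le> card B"
proof -
  have "\<exists>u\<in>U. (\<forall>s\<in>R - {r}. act u s = 0\<^sub>v (fst s)) \<and> act u r \<noteq> 0\<^sub>v (fst r)" if "r \<in> R" for r
  proof (rule separating_element[OF U])
    fix s assume "s \<in> insert r (R - {r})"
    then show "irreducible_fam (fst s) ((\<lambda>x. mat_at x s) ` X)" using irr that by blast
  qed (use that R non in blast)+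
  then obtain f where f: "\<And>r. r \<in> R \<Longrightarrow> f r \<in> U"
    "\<And>r s. r \<in> R \<Longrightarrow> s \<in> R \<Longrightarrow> s \<noteq> r \<Longrightarrow> act (f r) s = 0\<^sub>v (fst s)"
    "\<And>r. r \<in> R \<Longrightarrow> act (f r) r \<noteq> 0\<^sub>v (fst r)" by (metis Diff_iff singletonD)
  have inj: "inj_on f R" using f(2,3) by (metis inj_onI)
  have "fam.independent (f ` R)"
    unfolding fam.dependent_def
  proof clarify
    fix r assume r: "r \<in> R" "f r \<in> fam.span (f ` R - {f r})"
    have "fam.span (f ` R - {f r}) \<subseteq> {u. act u r = 0\<^sub>v (fst r)}"
    proof (rule fam.span_minimal)
      show "f ` R - {f r} \<subseteq> {u. act u r = 0\<^sub>v (fst r)}" using f(2) r(1) by blast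
    qed (auto simp: fam.subspace_def act_ops)
    then show False using r f(3) by blast
  qed
  then have "card (f ` R) \<le> card B"
    using fam.independent_span_bound[OF B(1)] f(1) B(2) by blast
  then show ?thesis using inj by (simp add: card_image)
qed

theorem finitely_many_irreducibles:
  assumes U: "left_ideal X U" "1 \<in> U" and B: "finite B" "U \<subseteq> fam.span B"
    and irr: "\<And>r. r \<in> C \<Longrightarrow> irreducible_fam (fst r) ((\<lambda>x. mat_at x r) ` X)"
  shows "\<exists>S\<subseteq>C. finite S \<and> (\<forall>r\<in>C. \<exists>s\<in>S. intertwined X r s)"
proof -
  \<comment> \<open>\<open>C\<close> may be infinite, but the sizes of such \<open>R\<close> are
    bounded by card B, so one of largest size exists; it meets every class, since otherwise it could
    be enlarged.\<close>
  let ?P = "\<lambda>R. R \<subseteq> C \<and> finite R \<and> (\<forall>r\<in>R. \<forall>s\<in>R. r \<noteq> s \<longrightarrow> \<not> intertwined X s r)"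
  have bound: "card R \<le> card B" if "?P R" for R
    using that irr by (intro card_pairwise_inequivalent[OF U B]) auto
  have "?P {}" by simp
  then have "\<exists>R. ?P R \<and> (\<forall>R'. ?P R' \<longrightarrow> card R' \<le> card R)"
    by (rule ex_has_greatest_nat[of ?P "{}" card "Suc (card B)"]) (use bound in \<open>simp add: less_Suc_eq_le\<close>)
  then obtain R where R: "?P R" "\<And>R'. ?P R' \<Longrightarrow> card R' \<le> card R" by blast
  have "\<exists>s\<in>R. intertwined X r s" if r: "r \<in> C" for r
  proof (cases "r \<in> R")
    case True then show ?thesis using intertwined_refl by blast
  next
    case False
    then have "card (insert r R) > card R" using R(1) by simp
    then have "\<not> ?P (insert r R)" using R(2)[of "insert r R"] not_le by blast
    then obtain s where "s \<in> R" "intertwined X s r \<or> intertwined X r s"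
      using R(1) r by blast
    then show ?thesis using intertwined_sym by blast
  qed
  then show ?thesis using R(1) by blast
qed

section \<open>Coordinates, and families supported on a set of representations\<close>

lemma carrier_vec_unit_induct [consumes 1, case_names zero step]:
  fixes x :: cv
  assumes x: "x \<in> carrier_vec m" and zero: "P (0\<^sub>v m)"
    and step: "\<And>c j y. j < m \<Longrightarrow> y \<in> carrier_vec m \<Longrightarrow> P y \<Longrightarrow> P (y + c \<cdot>\<^sub>v unit_vec m j)"
  shows "P x"
proof -
  let ?v = "\<lambda>k. vec m (\<lambda>i. if i < k then x $ i else 0)"
  have "P (?v k)" if "k \<le> m" for k
    using that
  proof (induction k)
    case 0
    have "?v 0 = 0\<^sub>v m" by (intro eq_vecI) auto
    then show ?case using zero by simp
  next
    case (Suc k)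
    have "?v (Suc k) = ?v k + x $ k \<cdot>\<^sub>v unit_vec m k"
      using Suc.prems by (intro eq_vecI) (auto simp: less_Suc_eq)
    then show ?case using Suc step[of k "?v k" "x $ k"] by simp
  qed
  moreover have "?v m = x" using x by (intro eq_vecI) auto
  ultimately show ?thesis by (metis order_refl)
qed

lemma mat_of_linear_map:
  assumes f: "\<And>x. x \<in> carrier_vec m \<Longrightarrow> f x \<in> carrier_vec k"
    and add: "\<And>x y. x \<in> carrier_vec m \<Longrightarrow> y \<in> carrier_vec m \<Longrightarrow> f (x + y) = f x + f y"
    and smult: "\<And>c x. x \<in> carrier_vec m \<Longrightarrow> f (c \<cdot>\<^sub>v x) = c \<cdot>\<^sub>v (f x :: cv)"
    and x: "x \<in> carrier_vec m"
  shows "mat k m (\<lambda>(i, j). f (unit_vec m j) $ i) *\<^sub>v x = f x"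
  using x
proof (induction rule: carrier_vec_unit_induct)
  case zero
  have "f (0 \<cdot>\<^sub>v 0\<^sub>v m) = 0 \<cdot>\<^sub>v f (0\<^sub>v m)" by (rule smult) simp
  moreover have "0 \<cdot>\<^sub>v f (0\<^sub>v m) = 0\<^sub>v k" using f[of "0\<^sub>v m"] by (intro eq_vecI) auto
  moreover have "0 \<cdot>\<^sub>v 0\<^sub>v m = (0\<^sub>v m :: cv)" by (intro eq_vecI) auto
  ultimately have "f (0\<^sub>v m) = 0\<^sub>v k" by simp
  moreover have "mat k m (\<lambda>(i, j). f (unit_vec m j) $ i) *\<^sub>v 0\<^sub>v m = 0\<^sub>v k" by (intro eq_vecI) auto
  ultimately show ?case by simp
next
  case (step c j y)
  let ?M = "mat k m (\<lambda>(i, j). f (unit_vec m j) $ i)"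
  have "?M *\<^sub>v (y + c \<cdot>\<^sub>v unit_vec m j) = ?M *\<^sub>v y + c \<cdot>\<^sub>v (?M *\<^sub>v unit_vec m j)"
    using step by (simp add: mult_add_distrib_mat_vec[of _ k m] mult_mat_vec[of _ k m])
  also have "?M *\<^sub>v unit_vec m j = f (unit_vec m j)"
    using step f[of "unit_vec m j"] by (intro eq_vecI) auto
  finally show ?case using step by (simp add: add smult)
qed

text \<open>With zero outside \<open>C\<close>, polynomial relations without constant term that hold
  at every index of \<open>C\<close> become relations between families.\<close>

definition restrict_family :: "(nat \<times> 's) set \<Rightarrow> (nat \<times> 's \<Rightarrow> cm) \<Rightarrow> 's mat_family" where
  "restrict_family C M = family (\<lambda>r. if r \<in> C then M r else 0\<^sub>m (fst r) (fst r))"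

lemma mat_at_restrict:
  "(\<And>r. r \<in> C \<Longrightarrow> M r \<in> carrier_mat (fst r) (fst r)) \<Longrightarrow>
    mat_at (restrict_family C M) r = (if r \<in> C then M r else 0\<^sub>m (fst r) (fst r))"
  unfolding restrict_family_def by (rule mat_at_family) simp

text \<open>One linear combination of unit vectors serves all indices at once, so \<open>m\<close>
  families generate everything however large \<open>C\<close> is.\<close>

lemma restrict_family_in_span:
  assumes lin: "\<And>r. r \<in> C \<Longrightarrow> lin_map m (fst r) (f r)" and x: "x \<in> carrier_vec m"
  shows "restrict_family C (\<lambda>r. f r x)
    \<in> fam.span ((\<lambda>j. restrict_family C (\<lambda>r. f r (unit_vec m j))) ` {..<m})"
  using x
proof (induction rule: carrier_vec_unit_induct)
  case zero
  have "f r (0\<^sub>v m) = 0\<^sub>m (fst r) (fst r)" if "r \<in> C" for r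
  proof -
    have "f r (0 \<cdot>\<^sub>v 0\<^sub>v m) = 0 \<cdot>\<^sub>m f r (0\<^sub>v m)" using lin[OF that] by (simp add: lin_map_def)
    moreover have "0 \<cdot>\<^sub>v 0\<^sub>v m = (0\<^sub>v m :: cv)" by (intro eq_vecI) auto
    moreover have "f r (0\<^sub>v m) \<in> carrier_mat (fst r) (fst r)" using lin[OF that] by (simp add: lin_map_def)
    then have "0 \<cdot>\<^sub>m f r (0\<^sub>v m) = 0\<^sub>m (fst r) (fst r)" by (intro eq_matI) auto
    ultimately show ?thesis by simp
  qed
  then have "restrict_family C (\<lambda>r. f r (0\<^sub>v m)) = 0"
    by (intro mat_family_eqI) (auto simp: mat_at_restrict mat_at_ops)
  then show ?case by (simp add: fam.span_zero)
next
  case (step c j y)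
  let ?u = "\<lambda>j. restrict_family C (\<lambda>r. f r (unit_vec m j))"
  have c: "f r y \<in> carrier_mat (fst r) (fst r)" "f r (unit_vec m j) \<in> carrier_mat (fst r) (fst r)"
    "f r (y + c \<cdot>\<^sub>v unit_vec m j) = f r y + c \<cdot>\<^sub>m f r (unit_vec m j)" if "r \<in> C" for r
    using lin[OF that] step by (auto simp: lin_map_def)
  have "restrict_family C (\<lambda>r. f r (y + c \<cdot>\<^sub>v unit_vec m j))
    = restrict_family C (\<lambda>r. f r y) + fam_scale c (?u j)"
    using c by (intro mat_family_eqI) (auto simp: mat_at_restrict mat_at_ops mat_at_scale)
  moreover have "?u j \<in> fam.span (?u ` {..<m})" using step by (intro fam.span_base) auto
  ultimately show ?case using step by (simp add: fam.span_add fam.span_scale)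
qed

lemma restrict_family_mult:
  assumes "\<And>r. r \<in> C \<Longrightarrow> M r \<in> carrier_mat (fst r) (fst r)" "\<And>r. r \<in> C \<Longrightarrow> N r \<in> carrier_mat (fst r) (fst r)"
  shows "restrict_family C M * restrict_family C N = restrict_family C (\<lambda>r. M r * N r)"
proof (rule mat_family_eqI)
  fix r
  have "\<And>r. r \<in> C \<Longrightarrow> M r * N r \<in> carrier_mat (fst r) (fst r)"
    using assms by (rule mult_carrier_mat)
  then show "mat_at (restrict_family C M * restrict_family C N) r = mat_at (restrict_family C (\<lambda>r. M r * N r)) r"
    using assms by (simp add: mat_at_restrict mat_at_ops)
qed

lemma restrict_family_add:
  assumes "\<And>r. r \<in> C \<Longrightarrow> M r \<in> carrier_mat (fst r) (fst r)" "\<And>r. r \<in> C \<Longrightarrow> N r \<in> carrier_mat (fst r) (fst r)"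
  shows "restrict_family C M + restrict_family C N = restrict_family C (\<lambda>r. M r + N r)"
  using assms by (intro mat_family_eqI) (simp add: mat_at_restrict mat_at_ops)

lemma restrict_family_diff:
  assumes "\<And>r. r \<in> C \<Longrightarrow> M r \<in> carrier_mat (fst r) (fst r)" "\<And>r. r \<in> C \<Longrightarrow> N r \<in> carrier_mat (fst r) (fst r)"
  shows "restrict_family C M - restrict_family C N = restrict_family C (\<lambda>r. M r - N r)"
  using assms by (intro mat_family_eqI) (simp add: mat_at_restrict mat_at_ops minus_carrier_mat)

lemma restrict_family_uminus:
  assumes "\<And>r. r \<in> C \<Longrightarrow> M r \<in> carrier_mat (fst r) (fst r)"
  shows "- restrict_family C M = restrict_family C (\<lambda>r. - M r)"
  using assms by (intro mat_family_eqI) (auto simp add: mat_at_restrict mat_at_ops)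

lemma restrict_family_cong:
  "(\<And>r. r \<in> C \<Longrightarrow> M r = N r) \<Longrightarrow> restrict_family C M = restrict_family C N"
  unfolding restrict_family_def by (rule arg_cong[of _ _ family]) (simp add: fun_eq_iff)

lemma comm_carrier:
  "A \<in> carrier_mat n n \<Longrightarrow> B \<in> carrier_mat n n \<Longrightarrow> comm A B \<in> carrier_mat n n"
  unfolding comm_def by (simp add: minus_carrier_mat)

lemma restrict_family_comm:
  assumes "\<And>r. r \<in> C \<Longrightarrow> M r \<in> carrier_mat (fst r) (fst r)" "\<And>r. r \<in> C \<Longrightarrow> N r \<in> carrier_mat (fst r) (fst r)"
  shows "restrict_family C M * restrict_family C N - restrict_family C N * restrict_family C M
    = restrict_family C (\<lambda>r. comm (M r) (N r))"
proof -
  have "\<And>r. r \<in> C \<Longrightarrow> M r * N r \<in> carrier_mat (fst r) (fst r)"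
    "\<And>r. r \<in> C \<Longrightarrow> N r * M r \<in> carrier_mat (fst r) (fst r)"
    using assms by (blast intro: mult_carrier_mat)+
  then show ?thesis
    using assms by (simp add: restrict_family_mult restrict_family_diff comm_def)
qed

lemma left_ideal_span:
  assumes "fam.subspace U" "\<And>x u. x \<in> X \<Longrightarrow> u \<in> U \<Longrightarrow> x * u \<in> U"
  shows "left_ideal (fam.span X) U"
  unfolding left_ideal_def
proof (intro conjI ballI)
  fix x u assume "x \<in> fam.span X" "u \<in> U"
  then show "x * u \<in> U"
    using fam.span_mult_left_subspace[of x X U u] assms by simp
qed (rule assms(1))

lemma left_ideal_mono: "left_ideal X U \<Longrightarrow> Y \<subseteq> X \<Longrightarrow> left_ideal Y U"
  by (auto simp: left_ideal_def)

section \<open>Usual and Jacobson representations\<close>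

text \<open>The right-hand side of \<open>cubic\<close> consists of words of length at most 2 in
  linear images, hence lies in \<open>fil\<close> of degree 2 over the images of the unit vectors.
  This is the hypothesis of the alternating-word argument.\<close>

lemma finitely_many_alternating_reps:
  fixes C :: "(nat \<times> (cv \<Rightarrow> cm)) set"
  defines "\<Phi> \<equiv> \<lambda>x. restrict_family C (\<lambda>r. snd r x)"
  assumes bil: "bilinear_on m jm"
    and lin: "\<And>r. r \<in> C \<Longrightarrow> lin_map m (fst r) (snd r)"
    and irr: "\<And>r. r \<in> C \<Longrightarrow> irreducible_fam (fst r) (snd r ` carrier_vec m)"
    and cubic: "\<And>x y z. x \<in> carrier_vec m \<Longrightarrow> y \<in> carrier_vec m \<Longrightarrow> z \<in> carrier_vec m \<Longrightarrow>
      \<Phi> x * \<Phi> y * \<Phi> z + \<Phi> z * \<Phi> y * \<Phi> x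
      = \<Phi> (jm x y) * \<Phi> z + \<Phi> (jm y z) * \<Phi> x + \<Phi> (jm x z) * \<Phi> y - \<Phi> (jm (jm x z) y)"
  shows "\<exists>S. finite S \<and> (\<forall>r\<in>C. \<exists>s\<in>S. rep_equiv m (fst r) (snd r) (fst s) (snd s))"
proof -
  let ?X = "(\<lambda>j. \<Phi> (unit_vec m j)) ` {..<m}"
  have span: "\<Phi> x \<in> fam.span ?X" if "x \<in> carrier_vec m" for x
    unfolding \<Phi>_def using restrict_family_in_span[of C m snd, OF lin that] .
  have jm: "jm x y \<in> carrier_vec m" if "x \<in> carrier_vec m" "y \<in> carrier_vec m" for x y
    using bil that by (auto simp: bilinear_on_def)
  have fil2: "u * v \<in> fam.fil ?X 2" if "u \<in> fam.span ?X" "v \<in> fam.span ?X" for u v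
    using fam.fil_mult[of u ?X 1 v 1] fam.span_subset_fil[of 1 ?X] that by (auto simp: numeral_2_eq_2)
  have "\<exists>U B. fam.subspace U \<and> finite B \<and> U \<subseteq> fam.span B \<and> 1 \<in> U \<and> (\<forall>x\<in>?X. \<forall>u\<in>U. x * u \<in> U)"
  proof (rule fam.finite_dimensional_left_ideal_of_alternating)
    fix a b c assume "a \<in> ?X" "b \<in> ?X" "c \<in> ?X"
    moreover have "\<exists>x\<in>carrier_vec m. u = \<Phi> x" if u: "u \<in> ?X" for u
    proof -
      from u obtain j where "u = \<Phi> (unit_vec m j)" by blast
      then show ?thesis by (intro bexI[of _ "unit_vec m j"]) simp_all
    qed
    ultimately obtain x y z where xyz: "x \<in> carrier_vec m" "y \<in> carrier_vec m" "z \<in> carrier_vec m"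
      "a = \<Phi> x" "b = \<Phi> y" "c = \<Phi> z" by meson
    have "\<Phi> (jm (jm x z) y) \<in> fam.fil ?X 2"
      using span[of "jm (jm x z) y"] fam.span_subset_fil[of 2 ?X] jm xyz by auto
    then show "a * b * c + c * b * a \<in> fam.fil ?X 2"
      unfolding xyz(4-6) cubic[OF xyz(1-3)]
      by (intro fam.subspace_add fam.subspace_diff fam.subspace_fil fil2 span jm xyz)
  qed simp
  then obtain U B where UB: "fam.subspace U" "finite B" "U \<subseteq> fam.span B" "1 \<in> U"
    "\<And>x u. x \<in> ?X \<Longrightarrow> u \<in> U \<Longrightarrow> x * u \<in> U" by blast
  let ?Y = "\<Phi> ` carrier_vec m"
  have U: "left_ideal ?Y U"
    by (rule left_ideal_mono[OF left_ideal_span[OF UB(1,5)] image_subsetI[OF span]])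
  have at: "mat_at (\<Phi> x) r = snd r x" if "x \<in> carrier_vec m" "r \<in> C" for x r
    unfolding \<Phi>_def using lin that by (subst mat_at_restrict) (auto simp: lin_map_def)
  have "\<exists>S\<subseteq>C. finite S \<and> (\<forall>r\<in>C. \<exists>s\<in>S. intertwined ?Y r s)"
  proof (rule finitely_many_irreducibles[OF U UB(4,2,3)])
    fix r assume r: "r \<in> C"
    have "(\<lambda>x. mat_at x r) ` ?Y = snd r ` carrier_vec m"
      unfolding image_image using at[OF _ r] by (intro image_cong) auto
    then show "irreducible_fam (fst r) ((\<lambda>x. mat_at x r) ` ?Y)" using irr[OF r] by simp
  qed
  then obtain S where S: "S \<subseteq> C" "finite S" "\<And>r. r \<in> C \<Longrightarrow> \<exists>s\<in>S. intertwined ?Y r s" by blast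
  have "rep_equiv m (fst r) (snd r) (fst s) (snd s)" if "r \<in> C" "s \<in> S" "intertwined ?Y r s" for r s
  proof -
    from that(2) S(1) have "s \<in> C" by blast
    from that(3) obtain F where F: "fst r = fst s" "F \<in> carrier_mat (fst r) (fst r)" "invertible_mat F"
      "\<And>x. x \<in> ?Y \<Longrightarrow> F * mat_at x r = mat_at x s * F" unfolding intertwined_def by blast
    have "F * snd r x = snd s x * F" if "x \<in> carrier_vec m" for x
      using F(4)[OF imageI[OF that]] at[OF that \<open>r \<in> C\<close>] at[OF that \<open>s \<in> C\<close>] by simp
    then show ?thesis using F(1-3) unfolding rep_equiv_def by blast
  qed
  then show ?thesis using S(2,3) by meson
qed

lemma fin_up_to_rep_equiv:
  assumes "\<exists>S. finite S \<and> (\<forall>r\<in>{(n, \<phi>). P n \<phi>}. \<exists>s\<in>S. rep_equiv m (fst r) (snd r) (fst s) (snd s))"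
  shows "fin_up_to (\<lambda>(n, \<phi>). P n \<phi>) (\<lambda>(n, \<phi>) (n', \<phi>'). rep_equiv m n \<phi> n' \<phi>')"
proof -
  obtain S where "finite S" and S: "\<And>r. r \<in> {(n, \<phi>). P n \<phi>} \<Longrightarrow> \<exists>s\<in>S. rep_equiv m (fst r) (snd r) (fst s) (snd s)"
    using assms by blast
  moreover have "\<exists>s\<in>S. case s of (n', \<phi>') \<Rightarrow> rep_equiv m n \<phi> n' \<phi>'" if "P n \<phi>" for n \<phi>
    using S[of "(n, \<phi>)"] that by (auto simp: case_prod_beta)
  ultimately show ?thesis unfolding fin_up_to_def by (intro exI[of _ S]) auto
qed

lemma finitely_many_usual_reps:
  assumes bil: "bilinear_on m jm"
  shows "fin_up_to (\<lambda>(n, \<phi>). usual_rep m jm n \<phi> \<and> irreducible_fam n (\<phi> ` carrier_vec m))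
    (\<lambda>(n, \<phi>) (n', \<phi>'). rep_equiv m n \<phi> n' \<phi>')"
proof (rule fin_up_to_rep_equiv)
  let ?C = "{(n, \<phi>). usual_rep m jm n \<phi> \<and> irreducible_fam n (\<phi> ` carrier_vec m)}"
  let ?\<Phi> = "\<lambda>x. restrict_family ?C (\<lambda>r. snd r x)"
  have C: "lin_map m (fst r) (snd r)" "irreducible_fam (fst r) (snd r ` carrier_vec m)"
    if "r \<in> ?C" for r using that by (auto simp: usual_rep_def)
  then have Cc: "snd r x \<in> carrier_mat (fst r) (fst r)" if "r \<in> ?C" "x \<in> carrier_vec m" for r x
    using that by (auto simp: lin_map_def)
  have jm: "jm x y \<in> carrier_vec m" if "x \<in> carrier_vec m" "y \<in> carrier_vec m" for x y
    using bil that by (auto simp: bilinear_on_def)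
  have usual: "?\<Phi> (jm x y) = ?\<Phi> x * ?\<Phi> y + ?\<Phi> y * ?\<Phi> x"
    if "x \<in> carrier_vec m" "y \<in> carrier_vec m" for x y :: cv
  proof -
    have "?\<Phi> x * ?\<Phi> y + ?\<Phi> y * ?\<Phi> x
      = restrict_family ?C (\<lambda>r. snd r x * snd r y) + restrict_family ?C (\<lambda>r. snd r y * snd r x)"
      using Cc that by (simp only: restrict_family_mult)
    also have "\<dots> = restrict_family ?C (\<lambda>r. snd r x * snd r y + snd r y * snd r x)"
      by (intro restrict_family_add mult_carrier_mat[OF Cc Cc] that)
    also have "\<dots> = ?\<Phi> (jm x y)"
      using that by (intro restrict_family_cong) (auto simp: usual_rep_def)
    finally show ?thesis by simp
  qed
  show "\<exists>S. finite S \<and> (\<forall>r\<in>?C. \<exists>s\<in>S. rep_equiv m (fst r) (snd r) (fst s) (snd s))"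
  proof (rule finitely_many_alternating_reps[OF bil])
    fix x y z :: cv assume xyz: "x \<in> carrier_vec m" "y \<in> carrier_vec m" "z \<in> carrier_vec m"
    show "?\<Phi> x * ?\<Phi> y * ?\<Phi> z + ?\<Phi> z * ?\<Phi> y * ?\<Phi> x
      = ?\<Phi> (jm x y) * ?\<Phi> z + ?\<Phi> (jm y z) * ?\<Phi> x + ?\<Phi> (jm x z) * ?\<Phi> y - ?\<Phi> (jm (jm x z) y)"
      \<comment> \<open>With every image of a product replaced by an anticommutator, the cubic
        identity holds in any associative ring.\<close>
      unfolding usual[OF jm[OF xyz(1,3)] xyz(2)] usual[OF xyz(1,2)] usual[OF xyz(2,3)] usual[OF xyz(1,3)]
      by (simp add: algebra_simps)
  qed (fact C)+
qed

text \<open>The V-component of the Jordan identity for the pair (x, u), (y, 0), read as an identity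
  of operators applied to u.\<close>

lemma jacobson_rep_quadratic:
  assumes bil: "bilinear_on m jm" and jac: "jacobson_rep m jm n \<phi>"
    and x: "x \<in> carrier_vec m" and y: "y \<in> carrier_vec m"
  shows "\<phi> (jm (jm x x) y) + (\<phi> x * \<phi> y * \<phi> x + \<phi> x * \<phi> y * \<phi> x)
    = \<phi> (jm x x) * \<phi> y + (\<phi> (jm y x) * \<phi> x + \<phi> (jm y x) * \<phi> x)"
proof -
  have jm: "jm x y \<in> carrier_vec m" if "x \<in> carrier_vec m" "y \<in> carrier_vec m" for x y
    using bil that by (auto simp: bilinear_on_def)
  have \<phi>: "\<phi> x \<in> carrier_mat n n" if "x \<in> carrier_vec m" for x
    using jac that by (auto simp: jacobson_rep_def lin_map_def)
  let ?j = "\<lambda>(x, u) (y, v). (jm x y, \<phi> x *\<^sub>v v + \<phi> y *\<^sub>v u)"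
  show ?thesis
  proof (rule mat_eq_by_mult_vec)
    fix u :: cv assume u: "u \<in> carrier_vec n"
    have zero: "A *\<^sub>v 0\<^sub>v n = 0\<^sub>v n" if "A \<in> carrier_mat n n" for A :: cm
      using that by (intro eq_vecI) auto
    have "snd (?j (?j (?j (x, u) (x, u)) (y, 0\<^sub>v n)) (x, u)) = snd (?j (?j (x, u) (x, u)) (?j (y, 0\<^sub>v n) (x, u)))"
      using jac x y u unfolding jacobson_rep_def jordan_identity_def by (metis (no_types, lifting) SigmaI zero_carrier_vec)
    then show "(\<phi> (jm (jm x x) y) + (\<phi> x * \<phi> y * \<phi> x + \<phi> x * \<phi> y * \<phi> x)) *\<^sub>v u
      = (\<phi> (jm x x) * \<phi> y + (\<phi> (jm y x) * \<phi> x + \<phi> (jm y x) * \<phi> x)) *\<^sub>v u"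
      using x y u jm \<phi> by (simp add: zero add_mult_distrib_mat_vec[of _ n n] mult_add_distrib_mat_vec[of _ n n]
          assoc_mult_mat_vec[of _ n n _ n] mult_mat_vec_carrier[of _ n n]
          mult_carrier_mat[of _ n n _ n] del: assoc_mult_mat)
  qed (use x y jm \<phi> in \<open>auto intro!: add_carrier_mat mult_carrier_mat[of _ n n _ n]\<close>)
qed

lemma finitely_many_jacobson_reps:
  assumes bil: "bilinear_on m jm"
    and comm: "\<And>x y. x \<in> carrier_vec m \<Longrightarrow> y \<in> carrier_vec m \<Longrightarrow> jm x y = jm y x"
  shows "fin_up_to (\<lambda>(n, \<phi>). jacobson_rep m jm n \<phi> \<and> irreducible_fam n (\<phi> ` carrier_vec m))
    (\<lambda>(n, \<phi>) (n', \<phi>'). rep_equiv m n \<phi> n' \<phi>')"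
proof (rule fin_up_to_rep_equiv)
  let ?C = "{(n, \<phi>). jacobson_rep m jm n \<phi> \<and> irreducible_fam n (\<phi> ` carrier_vec m)}"
  define \<Phi> where "\<Phi> x = restrict_family ?C (\<lambda>r. snd r x)" for x
  have C: "lin_map m (fst r) (snd r)" "irreducible_fam (fst r) (snd r ` carrier_vec m)"
    if "r \<in> ?C" for r using that by (auto simp: jacobson_rep_def)
  then have Cc: "snd r x \<in> carrier_mat (fst r) (fst r)" if "r \<in> ?C" "x \<in> carrier_vec m" for r x
    using that by (auto simp: lin_map_def)
  have jm: "jm x y \<in> carrier_vec m" if "x \<in> carrier_vec m" "y \<in> carrier_vec m" for x y
    using bil that by (auto simp: bilinear_on_def)
  have at: "mat_at (\<Phi> x) r = (if r \<in> ?C then snd r x else 0\<^sub>m (fst r) (fst r))" if "x \<in> carrier_vec m" for x r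
    unfolding \<Phi>_def by (rule mat_at_restrict) (rule Cc[OF _ that])
  have add: "\<Phi> (x + y) = \<Phi> x + \<Phi> y" if "x \<in> carrier_vec m" "y \<in> carrier_vec m" for x y
  proof (rule mat_family_eqI)
    fix r show "mat_at (\<Phi> (x + y)) r = mat_at (\<Phi> x + \<Phi> y) r"
      using that C(1)[of r] by (simp add: at mat_at_ops lin_map_def)
  qed
  have quad: "\<Phi> (jm (jm x x) y) + (\<Phi> x * \<Phi> y * \<Phi> x + \<Phi> x * \<Phi> y * \<Phi> x)
    = \<Phi> (jm x x) * \<Phi> y + (\<Phi> (jm y x) * \<Phi> x + \<Phi> (jm y x) * \<Phi> x)"
    if "x \<in> carrier_vec m" "y \<in> carrier_vec m" for x y
  proof (rule mat_family_eqI)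
    fix r
    show "mat_at (\<Phi> (jm (jm x x) y) + (\<Phi> x * \<Phi> y * \<Phi> x + \<Phi> x * \<Phi> y * \<Phi> x)) r
      = mat_at (\<Phi> (jm x x) * \<Phi> y + (\<Phi> (jm y x) * \<Phi> x + \<Phi> (jm y x) * \<Phi> x)) r"
    proof (cases "r \<in> ?C")
      case True
      then have "jacobson_rep m jm (fst r) (snd r)" by auto
      from jacobson_rep_quadratic[OF bil this that] show ?thesis
        using True that jm by (simp only: at mat_at_ops if_True)
    next
      case False
      then show ?thesis using that jm by (simp add: at mat_at_ops)
    qed
  qed
  show "\<exists>S. finite S \<and> (\<forall>r\<in>?C. \<exists>s\<in>S. rep_equiv m (fst r) (snd r) (fst s) (snd s))"
  proof (rule finitely_many_alternating_reps[OF bil], fold \<Phi>_def)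
    fix x y z :: cv assume xyz: "x \<in> carrier_vec m" "y \<in> carrier_vec m" "z \<in> carrier_vec m"
    note [simp] = xyz jm add
    have d: "jm (u + v) w = jm u w + jm v w" "jm w (u + v) = jm w u + jm w v"
      if "u \<in> carrier_vec m" "v \<in> carrier_vec m" "w \<in> carrier_vec m" for u v w
      using bil that by (auto simp: bilinear_on_def)
    have half: "u = v" if "u + u = v + v" for u v :: "(cv \<Rightarrow> cm) mat_family"
    proof -
      have "fam_scale 2 u = fam_scale 2 v"
        using that fam.scale_left_distrib[of 1 1 u] fam.scale_left_distrib[of 1 1 v] by simp
      then have "fam_scale (1/2) (fam_scale 2 u) = fam_scale (1/2) (fam_scale 2 v)" by simp
      then show ?thesis by simp
    qed
    let ?L = "\<Phi> x * \<Phi> y * \<Phi> z + \<Phi> z * \<Phi> y * \<Phi> x"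
    let ?R = "\<Phi> (jm x y) * \<Phi> z + \<Phi> (jm y z) * \<Phi> x + \<Phi> (jm x z) * \<Phi> y - \<Phi> (jm (jm x z) y)"
    have c: "jm z x = jm x z" "jm y x = jm x y" "jm z y = jm y z" using comm xyz by auto
    \<comment> \<open>Polarization: the quadratic identity at x + z minus those at x and z leaves
      the part linear in both, which is twice the cubic identity.\<close>
    note q1 = quad[OF add_carrier_vec[OF xyz(1,3)] xyz(2), simplified d add jm xyz add_carrier_vec distrib_left distrib_right c]
    have "?L + ?L = ?R + ?R"
      using q1 unfolding quad[OF xyz(1,2), unfolded c, folded eq_diff_eq]
        quad[OF xyz(3,2), unfolded c, folded eq_diff_eq]
      by (simp add: algebra_simps)
    then show "?L = ?R" by (rule half)
  qed (fact C)+
qed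

section \<open>Jordan algebra identities\<close>

text \<open>Expanding at u + v mixes the parts of degree (2, 1) and (1, 2); replacing v by 2v scales
  them by 2 and 4 and so separates them. A further polarization in u gives all six permutations,
  which the symmetry pairs off.\<close>

lemma trilinear_polarization:
  fixes t :: "cv \<Rightarrow> cv \<Rightarrow> cv \<Rightarrow> complex"
  assumes add: "\<And>x x' y z. x \<in> carrier_vec m \<Longrightarrow> x' \<in> carrier_vec m \<Longrightarrow> y \<in> carrier_vec m \<Longrightarrow> z \<in> carrier_vec m \<Longrightarrow>
      t (x + x') y z = t x y z + t x' y z \<and> t y (x + x') z = t y x z + t y x' z \<and> t y z (x + x') = t y z x + t y z x'"
    and sym: "\<And>x y z. x \<in> carrier_vec m \<Longrightarrow> y \<in> carrier_vec m \<Longrightarrow> z \<in> carrier_vec m \<Longrightarrow> t x y z = t y x z"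
    and diag: "\<And>x. x \<in> carrier_vec m \<Longrightarrow> t x x x = 0"
    and xyz: "x \<in> carrier_vec m" "y \<in> carrier_vec m" "z \<in> carrier_vec m"
  shows "t x y z + t x z y + t y z x = 0"
proof -
  have e1: "t u u v + t u v u + t v u u + (t v v u + t v u v + t u v v) = 0"
    if "u \<in> carrier_vec m" "v \<in> carrier_vec m" for u v
  proof -
    have "t (u + v) (u + v) (u + v)
      = t u u u + t v v v + (t u u v + t u v u + t v u u + (t v v u + t v u v + t u v v))"
      using that by (simp add: add)
    then show ?thesis using diag[of "u + v"] diag[of u] diag[of v] that by simp
  qed
  have e2: "t u u v + t u v u + t v u u = 0" if uv: "u \<in> carrier_vec m" "v \<in> carrier_vec m" for u v
  proof -
    \<comment> \<open>Doubling is written as a sum because only additivity of \<open>t\<close> is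
      assumed.\<close>
    let ?w = "v + v"
    have 1: "t u u ?w = 2 * t u u v" "t u ?w u = 2 * t u v u" "t ?w u u = 2 * t v u u"
      using uv add by auto
    have 2: "t ?w ?w u = 4 * t v v u" "t ?w u ?w = 4 * t v u v" "t u ?w ?w = 4 * t u v v"
      using uv by (simp_all add: add)
    have "2 * t u u v + 2 * t u v u + 2 * t v u u + (4 * t v v u + 4 * t v u v + 4 * t u v v) = 0"
      using e1[of u ?w] uv unfolding 1 2 by simp
    with e1[OF uv] show ?thesis by (simp add: complex_eq_iff; linarith)
  qed
  have "t (x + y) (x + y) z = t x x z + t y y z + (t x y z + t y x z)"
    "t (x + y) z (x + y) = t x z x + t y z y + (t x z y + t y z x)"
    "t z (x + y) (x + y) = t z x x + t z y y + (t z x y + t z y x)"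
    using xyz by (simp_all add: add)
  with e2[of "x + y" z] e2[OF xyz(1,3)] e2[OF xyz(2,3)] xyz
  have "t x y z + t y x z + (t x z y + t y z x) + (t z x y + t z y x) = 0"
    by (simp add: complex_eq_iff; linarith)
  with sym[OF xyz(2,1,3)] sym[OF xyz(3,1,2)] sym[OF xyz(3,2,1)]
  show ?thesis by (simp add: complex_eq_iff; linarith)
qed

locale jordan =
  fixes m :: nat and jm :: jprod
  assumes jordan: "jordan_algebra m jm"
begin

abbreviation V :: "cv set" where "V \<equiv> carrier_vec m"

lemma jm_closed [simp]: "x \<in> V \<Longrightarrow> y \<in> V \<Longrightarrow> jm x y \<in> V"
  using jordan by (auto simp: jordan_algebra_def bilinear_on_def)

lemma dim_jm [simp]: "x \<in> V \<Longrightarrow> y \<in> V \<Longrightarrow> dim_vec (jm x y) = m"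
  using jm_closed[of x y] by (rule carrier_vecD)

lemma jm_comm: "x \<in> V \<Longrightarrow> y \<in> V \<Longrightarrow> jm x y = jm y x"
  using jordan unfolding jordan_algebra_def jordan_identity_def by blast

lemma jm_add:
  "x \<in> V \<Longrightarrow> x' \<in> V \<Longrightarrow> y \<in> V \<Longrightarrow> jm (x + x') y = jm x y + jm x' y"
  "x \<in> V \<Longrightarrow> x' \<in> V \<Longrightarrow> y \<in> V \<Longrightarrow> jm y (x + x') = jm y x + jm y x'"
  using jordan by (auto simp: jordan_algebra_def bilinear_on_def)

lemma jm_smult:
  "x \<in> V \<Longrightarrow> y \<in> V \<Longrightarrow> jm (c \<cdot>\<^sub>v x) y = c \<cdot>\<^sub>v jm x y"
  "x \<in> V \<Longrightarrow> y \<in> V \<Longrightarrow> jm y (c \<cdot>\<^sub>v x) = c \<cdot>\<^sub>v jm y x"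
  using jordan by (auto simp: jordan_algebra_def bilinear_on_def)

lemma jm_diff:
  assumes "x \<in> V" "x' \<in> V" "y \<in> V" shows "jm y (x - x') = jm y x - jm y x'"
proof -
  have "x - x' = x + (-1) \<cdot>\<^sub>v x'" using assms by (intro eq_vecI) auto
  then have "jm y (x - x') = jm y x + (-1) \<cdot>\<^sub>v jm y x'" using assms by (simp add: jm_add jm_smult)
  also have "\<dots> = jm y x - jm y x'" using assms by (intro eq_vecI) auto
  finally show ?thesis .
qed

text \<open>Full linearization of the Jordan identity in its repeated variable, taken coordinatewise
  so that the polarized form is complex valued.\<close>

lemma jordan_linearized:
  assumes "x \<in> V" "y \<in> V" "z \<in> V" "w \<in> V" "i < m"
  shows "jm (jm (jm x y) w) z $ i + jm (jm (jm x z) w) y $ i + jm (jm (jm y z) w) x $ i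
    = jm (jm x y) (jm w z) $ i + jm (jm x z) (jm w y) $ i + jm (jm y z) (jm w x) $ i"
proof -
  let ?t = "\<lambda>x y z. jm (jm (jm x y) w) z $ i - jm (jm x y) (jm w z) $ i"
  have "?t x y z + ?t x z y + ?t y z x = 0"
  proof (rule trilinear_polarization[of m ?t])
    fix x assume "x \<in> V"
    then have "jm (jm (jm x x) w) x = jm (jm x x) (jm w x)"
      using jordan assms(4) unfolding jordan_algebra_def jordan_identity_def by blast
    then show "jm (jm (jm x x) w) x $ i - jm (jm x x) (jm w x) $ i = 0" by simp
  next
    fix x y z assume "x \<in> V" "y \<in> V"
    then show "?t x y z = ?t y x z" by (simp only: jm_comm[of x y])
  qed (use assms in \<open>simp_all add: jm_add\<close>)
  then show ?thesis by (simp add: algebra_simps)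
qed

text \<open>In terms of the triple product \<open>{u y v} = Aa m jm y u v\<close> this reads
  \<open>x {u y v} - {(x u) y v} - {u y (x v)} = - {u (x y) v}\<close>.\<close>

lemma triple_product_derivation:
  assumes "x \<in> V" "y \<in> V" "u \<in> V" "v \<in> V"
  shows "jm x (jm (jm u y) v + jm (jm v y) u - jm y (jm u v))
     - (jm (jm (jm x u) y) v + jm (jm v y) (jm x u) - jm y (jm (jm x u) v))
     - (jm (jm u y) (jm x v) + jm (jm (jm x v) y) u - jm y (jm u (jm x v)))
     = (-1) \<cdot>\<^sub>v (jm (jm u (jm x y)) v + jm (jm v (jm x y)) u - jm (jm x y) (jm u v))"
proof (rule eq_vecI)
  note [simp] = assms
  fix i assume "i < dim_vec ((-1) \<cdot>\<^sub>v (jm (jm u (jm x y)) v + jm (jm v (jm x y)) u - jm (jm x y) (jm u v)))"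
  then have i: "i < m" by simp
  have c: "jm u y = jm y u" "jm v y = jm y v" "jm x y = jm y x" "jm u x = jm x u" "jm v x = jm x v" "jm u v = jm v u"
    by (simp_all add: jm_comm)
  have c3: "jm x (jm a b) = jm (jm a b) x" "jm y (jm a b) = jm (jm a b) y" "jm u (jm a b) = jm (jm a b) u"
    "jm v (jm a b) = jm (jm a b) v" if "a \<in> V" "b \<in> V" for a b using that by (simp_all add: jm_comm)
  have c4: "jm (jm y u) (jm x v) = jm (jm x v) (jm y u)" "jm (jm y v) (jm x u) = jm (jm x u) (jm y v)"
    "jm (jm y x) (jm v u) = jm (jm v u) (jm y x)" by (simp_all add: jm_comm)
  have "(jm x (jm (jm u y) v + jm (jm v y) u - jm y (jm u v))
     - (jm (jm (jm x u) y) v + jm (jm v y) (jm x u) - jm y (jm (jm x u) v))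
     - (jm (jm u y) (jm x v) + jm (jm (jm x v) y) u - jm y (jm u (jm x v)))) $ i
   = jm x (jm (jm u y) v) $ i + jm x (jm (jm v y) u) $ i - jm x (jm y (jm u v)) $ i
     - (jm (jm (jm x u) y) v $ i + jm (jm v y) (jm x u) $ i - jm y (jm (jm x u) v) $ i)
     - (jm (jm u y) (jm x v) $ i + jm (jm (jm x v) y) u $ i - jm y (jm u (jm x v)) $ i)"
    using i by (simp add: jm_add jm_diff)
  moreover have "((-1) \<cdot>\<^sub>v (jm (jm u (jm x y)) v + jm (jm v (jm x y)) u - jm (jm x y) (jm u v))) $ i
    = - (jm (jm u (jm x y)) v $ i + jm (jm v (jm x y)) u $ i - jm (jm x y) (jm u v) $ i)"
    using i by simp
  ultimately show "(jm x (jm (jm u y) v + jm (jm v y) u - jm y (jm u v))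
     - (jm (jm (jm x u) y) v + jm (jm v y) (jm x u) - jm y (jm (jm x u) v))
     - (jm (jm u y) (jm x v) + jm (jm (jm x v) y) u - jm y (jm u (jm x v)))) $ i
     = ((-1) \<cdot>\<^sub>v (jm (jm u (jm x y)) v + jm (jm v (jm x y)) u - jm (jm x y) (jm u v))) $ i"
    \<comment> \<open>The claim is the sum of the two linearized identities with \<open>u\<close>
      and with \<open>v\<close> as distinguished fourth variable, minus the one with
      \<open>y\<close>; most products of two products cancel.\<close>
    using jordan_linearized[OF assms(1,2,4,3) i] jordan_linearized[OF assms(1,2,3,4) i]
      jordan_linearized[OF assms(1,3,4,2) i]
    by (simp only: jm_closed assms c c3 c4 simp_thms) (simp add: complex_eq_iff; linarith)
qed (use assms in simp)

section \<open>Brackets of L(A) on the generators L_x and A_x\<close>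

lemma Lmat_carrier [simp]: "Lmat m jm x \<in> carrier_mat m m"
  by (simp add: Lmat_def)

lemma Lmat_mult_vec: "x \<in> V \<Longrightarrow> y \<in> V \<Longrightarrow> Lmat m jm x *\<^sub>v y = jm x y"
  unfolding Lmat_def by (rule mat_of_linear_map) (auto simp: jm_add jm_smult)

lemma Aa_apply: "u \<in> V \<Longrightarrow> v \<in> V \<Longrightarrow> Aa m jm x u v = jm (jm u x) v + jm (jm v x) u - jm x (jm u v)"
  by (simp add: Aa_def bres_def)

lemma Aa_add: "x \<in> V \<Longrightarrow> y \<in> V \<Longrightarrow> Aa m jm (x + y) = (\<lambda>u v. Aa m jm x u v + Aa m jm y u v)"
  unfolding Aa_def bres_def by (intro ext eq_vecI) (auto simp: jm_add)

lemma Aa_smult: "x \<in> V \<Longrightarrow> Aa m jm (c \<cdot>\<^sub>v x) = (\<lambda>u v. c \<cdot>\<^sub>v Aa m jm x u v)"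
  unfolding Aa_def bres_def by (intro ext eq_vecI) (auto simp: jm_smult algebra_simps)

text \<open>The triple product with the unit in the middle is the product itself. Hence the A_x
  alone exhaust U_1, and the operator a of a generalized representation is minus the image of
  A_e.\<close>

lemma Aa_unit: "jordan_unit m jm e \<Longrightarrow> Aa m jm e = Abar m jm"
proof (intro ext)
  fix u v assume e: "jordan_unit m jm e"
  have e': "jm e x = x" "jm x e = x" "e \<in> V" if "x \<in> V" for x
    using e that jm_comm[of e x] by (auto simp: jordan_unit_def)
  show "Aa m jm e u v = Abar m jm u v"
  proof (cases "u \<in> V \<and> v \<in> V")
    case True
    then have "Aa m jm e u v = jm u v + jm v u - jm u v" by (simp add: Aa_apply e')
    also have "\<dots> = jm u v" using True jm_comm[of v u] by (intro eq_vecI) auto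
    finally show ?thesis using True by (simp add: Abar_def bres_def)
  qed (auto simp: Abar_def Aa_def bres_def)
qed

text \<open>This is the operator v \<mapsto> {y x v} of the Jordan triple product, classically
  L_{xy} + [L_y, L_x].\<close>

lemma br_Ba_Aa:
  assumes "x \<in> V" "y \<in> V"
  shows "br_Ba m (Aa m jm x) y = Lmat m jm (jm x y) + comm (Lmat m jm y) (Lmat m jm x)"
proof (rule mat_eq_by_mult_vec[of _ m m])
  fix v assume v: "v \<in> V"
  have "br_Ba m (Aa m jm x) y *\<^sub>v v = Aa m jm x y v"
    unfolding br_Ba_def
  proof (rule mat_of_linear_map[OF _ _ _ v])
    fix u w assume "u \<in> V" "w \<in> V"
    then show "Aa m jm x y (u + w) = Aa m jm x y u + Aa m jm x y w"
      using assms by (intro eq_vecI) (auto simp: Aa_apply jm_add)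
  next
    fix c u assume "u \<in> V"
    then show "Aa m jm x y (c \<cdot>\<^sub>v u) = c \<cdot>\<^sub>v Aa m jm x y u"
      using assms by (intro eq_vecI) (auto simp: Aa_apply jm_smult algebra_simps)
  qed (use assms v in \<open>simp_all add: Aa_apply\<close>)
  also have "\<dots> = (Lmat m jm (jm x y) + comm (Lmat m jm y) (Lmat m jm x)) *\<^sub>v v"
    using assms v unfolding comm_def
    by (simp add: Aa_apply add_mult_distrib_mat_vec[of _ m m] minus_mult_distrib_mat_vec[of _ m m] Lmat_mult_vec
        assoc_mult_mat_vec[of _ m m _ m] mult_carrier_mat[of _ m m _ m] minus_carrier_mat[of _ m m])
       (intro eq_vecI; simp add: jm_comm[of y x] jm_comm[of x "jm y v"] jm_comm[of v x] jm_comm[of y "jm x v"])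
  finally show "br_Ba m (Aa m jm x) y *\<^sub>v v = (Lmat m jm (jm x y) + comm (Lmat m jm y) (Lmat m jm x)) *\<^sub>v v" .
qed (simp_all add: br_Ba_def comm_carrier)

text \<open>A restatement of \<open>triple_product_derivation\<close>: L_x acts on U_1 like on
  U_{-1}, but with the opposite sign.\<close>

lemma br_SB_Lmat_Aa:
  assumes "x \<in> V" "y \<in> V"
  shows "br_SB m (Lmat m jm x) (Aa m jm y) = (\<lambda>u v. (-1) \<cdot>\<^sub>v Aa m jm (jm x y) u v)"
proof (intro ext)
  fix u v
  show "br_SB m (Lmat m jm x) (Aa m jm y) u v = (-1) \<cdot>\<^sub>v Aa m jm (jm x y) u v"
  proof (cases "u \<in> V \<and> v \<in> V")
    case True
    then show ?thesis
      using triple_product_derivation[of x y u v] assms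
      by (simp add: br_SB_def bres_def Lmat_mult_vec Aa_apply)
  qed (auto simp: br_SB_def bres_def Aa_def)
qed

lemma lie_rep_Aa_linear:
  assumes lr: "lie_rep m jm n rm r0 r1"
  shows "lin_map m n (\<lambda>x. r1 (Aa m jm x))"
  unfolding lin_map_def
proof (intro conjI ballI allI)
  fix x y c assume x: "x \<in> V"
  show "r1 (Aa m jm x) \<in> carrier_mat n n"
    using lr U1_Aa[OF x, of jm] unfolding lie_rep_def by blast
  show "r1 (Aa m jm (c \<cdot>\<^sub>v x)) = c \<cdot>\<^sub>m r1 (Aa m jm x)"
    using lr U1_Aa[OF x, of jm] unfolding lie_rep_def Aa_smult[OF x] by blast
  assume y: "y \<in> V"
  show "r1 (Aa m jm (x + y)) = r1 (Aa m jm x) + r1 (Aa m jm y)"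
    using lr U1_Aa[OF x, of jm] U1_Aa[OF y, of jm] unfolding lie_rep_def Aa_add[OF x y] by blast
qed

lemma lie_rep_Lmat_carrier:
  assumes lr: "lie_rep m jm n rm r0 r1" and x: "x \<in> V"
  shows "r0 (Lmat m jm x) \<in> carrier_mat n n"
  using lr U0_L[OF x, of jm] unfolding lie_rep_def by simp

lemma lie_rep_comm_Lmat:
  assumes lr: "lie_rep m jm n rm r0 r1" and x: "x \<in> V" and y: "y \<in> V"
  shows "comm (r0 (Lmat m jm x)) (rm y) = rm (jm x y)"
    and "comm (r0 (Lmat m jm x)) (r1 (Aa m jm y)) = - r1 (Aa m jm (jm x y))"
proof -
  have "comm (r0 (Lmat m jm x)) (rm y) = rm (Lmat m jm x *\<^sub>v y)"
    using lr U0_L[OF x, of jm] y unfolding lie_rep_def by blast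
  then show "comm (r0 (Lmat m jm x)) (rm y) = rm (jm x y)" using x y by (simp add: Lmat_mult_vec)
  have "comm (r0 (Lmat m jm x)) (r1 (Aa m jm y)) = r1 (br_SB m (Lmat m jm x) (Aa m jm y))"
    using lr U0_L[OF x, of jm] U1_Aa[OF y, of jm] unfolding lie_rep_def by blast
  also have "\<dots> = (-1) \<cdot>\<^sub>m r1 (Aa m jm (jm x y))"
    using lr U1_Aa[OF jm_closed[OF x y], of jm] unfolding br_SB_Lmat_Aa[OF x y] lie_rep_def by blast
  also have "\<dots> = - r1 (Aa m jm (jm x y))" by (intro eq_matI) auto
  finally show "comm (r0 (Lmat m jm x)) (r1 (Aa m jm y)) = - r1 (Aa m jm (jm x y))" .
qed

text \<open>The second summand is kept as a commutator of images, so that its brackets with U_{-1}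
  and U_1 reduce to applying \<open>lie_rep_comm_Lmat\<close> twice.\<close>

lemma lie_rep_comm_Aa:
  assumes lr: "lie_rep m jm n rm r0 r1" and x: "x \<in> V" and y: "y \<in> V"
  shows "comm (r1 (Aa m jm x)) (rm y)
    = r0 (Lmat m jm (jm x y)) + comm (r0 (Lmat m jm y)) (r0 (Lmat m jm x))"
proof -
  have U: "Lmat m jm (jm x y) \<in> U0 m jm" "comm (Lmat m jm y) (Lmat m jm x) \<in> U0 m jm"
    using U0_L[OF jm_closed[OF x y], of jm] U0_comm[OF y x, of jm] by auto
  have "comm (r1 (Aa m jm x)) (rm y) = r0 (br_Ba m (Aa m jm x) y)"
    using lr U1_Aa[OF x, of jm] y unfolding lie_rep_def by blast
  also have "\<dots> = r0 (Lmat m jm (jm x y)) + r0 (comm (Lmat m jm y) (Lmat m jm x))"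
    using lr U unfolding br_Ba_Aa[OF x y] lie_rep_def by simp
  also have "r0 (comm (Lmat m jm y) (Lmat m jm x)) = comm (r0 (Lmat m jm y)) (r0 (Lmat m jm x))"
    using lr U0_L[OF x, of jm] U0_L[OF y, of jm] unfolding lie_rep_def by simp
  finally show ?thesis .
qed

end

section \<open>Graded representations\<close>

lemma mat_mult_zero_vec: "A \<in> carrier_mat n n \<Longrightarrow> A *\<^sub>v 0\<^sub>v n = (0\<^sub>v n :: cv)"
  by (intro eq_vecI) auto

lemma graded_decomp_csubspace: "graded_decomp n l Vs \<Longrightarrow> j \<in> {1..l} \<Longrightarrow> csubspace n (Vs j)"
  by (simp add: graded_decomp_def)

lemma Vz_shift:
  assumes g: "graded_decomp n l Vs" and A: "A \<in> carrier_mat n n"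
    and shift: "\<And>j v. j \<in> {1..l} \<Longrightarrow> v \<in> Vs j \<Longrightarrow> A *\<^sub>v v \<in> Vz n l Vs (int j + s)"
    and v: "v \<in> Vz n l Vs k"
  shows "A *\<^sub>v v \<in> Vz n l Vs (k + s)"
proof (cases "1 \<le> k \<and> k \<le> int l")
  case True
  then have "nat k \<in> {1..l}" "v \<in> Vs (nat k)" "int (nat k) = k" using v by (auto simp: Vz_def)
  then show ?thesis using shift[of "nat k" v] by simp
next
  case False
  then have "v = 0\<^sub>v n" using v unfolding Vz_def by (simp split: if_splits)
  moreover have "0\<^sub>v n \<in> Vz n l Vs i" for i
    using graded_decomp_csubspace[OF g, of "nat i"]
    by (cases "nat i \<in> {1..l}") (auto simp: Vz_def csubspace_def)
  ultimately show ?thesis using A by (simp add: mat_mult_zero_vec)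
qed

lemma graded_word_zero:
  fixes r :: "nat \<times> 's"
  assumes g: "graded_decomp (fst r) l Vs" and s: "s = 1 \<or> s = (-1 :: int)"
    and xs: "\<And>x k v. x \<in> set xs \<Longrightarrow> v \<in> Vz (fst r) l Vs k \<Longrightarrow> mat_at x r *\<^sub>v v \<in> Vz (fst r) l Vs (k + s)"
    and l: "length xs = l"
  shows "mat_at (prod_list xs) r = 0\<^sub>m (fst r) (fst r)"
proof -
  let ?n = "fst r" and ?A = "mat_at (prod_list xs) r"
  have sub: "Vs j \<subseteq> carrier_vec ?n" if "j \<in> {1..l}" for j
    using graded_decomp_csubspace[OF g that] by (simp add: csubspace_def)
  have Vzc: "Vz ?n l Vs k \<subseteq> carrier_vec ?n" for k
    using sub[of "nat k"] by (cases "nat k \<in> {1..l}") (auto simp: Vz_def)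
  have word: "mat_at (prod_list ys) r *\<^sub>v v \<in> Vz ?n l Vs (k + s * int (length ys))"
    if "set ys \<subseteq> set xs" "v \<in> Vz ?n l Vs k" for ys v k
    using that
  proof (induction ys)
    case Nil
    then have "v \<in> carrier_vec ?n" using Vzc[of k] by blast
    then show ?case using Nil by (simp add: mat_at_ops)
  next
    case (Cons y ys)
    have "mat_at (prod_list (y # ys)) r *\<^sub>v v = mat_at y r *\<^sub>v (mat_at (prod_list ys) r *\<^sub>v v)"
      using subsetD[OF Vzc Cons.prems(2)]
      by (simp add: mat_at_ops assoc_mult_mat_vec[OF mat_at_carrier mat_at_carrier])
    also have "\<dots> \<in> Vz ?n l Vs (k + s * int (length ys) + s)"
      using Cons by (intro xs) auto
    finally show ?case by (simp add: algebra_simps)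
  qed
  have kill: "?A *\<^sub>v v = 0\<^sub>v ?n" if j: "j \<in> {1..l}" "v \<in> Vs j" for j v
  proof -
    have "v \<in> Vz ?n l Vs (int j)" using j by (simp add: Vz_def)
    then have "?A *\<^sub>v v \<in> Vz ?n l Vs (int j + s * int l)" using word[of xs v "int j"] l by simp
    \<comment> \<open>With l shifts in one direction every j in 1..l leaves the range, where
      \<open>Vz\<close> is the zero space.\<close>
    moreover have "\<not> (1 \<le> int j + s * int l \<and> int j + s * int l \<le> int l)" using s j by auto
    ultimately show ?thesis by (simp add: Vz_def)
  qed
  have vs: "vsum ?n f k \<in> carrier_vec ?n \<and> ?A *\<^sub>v vsum ?n f k = 0\<^sub>v ?n"
    if "\<forall>j\<in>{1..l}. f j \<in> Vs j" "k \<le> l" for f k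
    using that(2)
  proof (induction k)
    case 0 then show ?case by (simp add: mat_mult_zero_vec)
  next
    case (Suc k)
    have "f (Suc k) \<in> carrier_vec ?n" "?A *\<^sub>v f (Suc k) = 0\<^sub>v ?n"
      using that(1) Suc.prems sub[of "Suc k"] kill[of "Suc k" "f (Suc k)"] by auto
    then show ?case using Suc by (simp add: mult_add_distrib_mat_vec[OF mat_at_carrier])
  qed
  show ?thesis
  proof (rule mat_eq_by_mult_vec[of _ ?n ?n])
    fix v :: cv assume v: "v \<in> carrier_vec ?n"
    then obtain f where f: "\<forall>j\<in>{1..l}. f j \<in> Vs j" "v = vsum ?n f l"
      using g unfolding graded_decomp_def by blast
    have "0\<^sub>m ?n ?n *\<^sub>v v = 0\<^sub>v ?n" using v by (intro eq_vecI) auto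
    then show "?A *\<^sub>v v = 0\<^sub>m ?n ?n *\<^sub>v v" using vs[OF f(1), of l] f(2) by simp
  qed simp_all
qed

lemma graded_family_word_zero:
  fixes f :: "nat \<times> 's \<Rightarrow> 'a \<Rightarrow> cm"
  assumes g: "\<And>r. r \<in> C \<Longrightarrow> graded_decomp (fst r) l (Vs r)" and s: "s = 1 \<or> s = (-1 :: int)"
    and f: "\<And>r i. r \<in> C \<Longrightarrow> i \<in> I \<Longrightarrow> f r i \<in> carrier_mat (fst r) (fst r)"
    and shift: "\<And>r i j v. r \<in> C \<Longrightarrow> i \<in> I \<Longrightarrow> j \<in> {1..l} \<Longrightarrow> v \<in> Vs r j \<Longrightarrow>
       f r i *\<^sub>v v \<in> Vz (fst r) l (Vs r) (int j + s)"
    and xs: "set xs \<subseteq> (\<lambda>i. restrict_family C (\<lambda>r. f r i)) ` I" and l: "length xs = l" "l \<ge> 1"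
  shows "prod_list xs = 0"
proof (rule mat_family_eqI)
  fix r
  have at: "mat_at (restrict_family C (\<lambda>r. f r i)) r = (if r \<in> C then f r i else 0\<^sub>m (fst r) (fst r))"
    if "i \<in> I" for i using f that by (intro mat_at_restrict) auto
  show "mat_at (prod_list xs) r = mat_at 0 r"
  proof (cases "r \<in> C")
    case True
    have "mat_at (prod_list xs) r = 0\<^sub>m (fst r) (fst r)"
    proof (rule graded_word_zero[OF g[OF True] s _ l(1)])
      fix x k v assume x: "x \<in> set xs" and v: "v \<in> Vz (fst r) l (Vs r) k"
      obtain i where i: "i \<in> I" "x = restrict_family C (\<lambda>r. f r i)" using x xs by auto
      have "f r i *\<^sub>v v \<in> Vz (fst r) l (Vs r) (k + s)"
        by (rule Vz_shift[OF g[OF True] f[OF True i(1)] shift[OF True i(1)] v])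
      then show "mat_at x r *\<^sub>v v \<in> Vz (fst r) l (Vs r) (k + s)" using at[OF i(1)] i(2) True by simp
    qed
    then show ?thesis by (simp add: mat_at_ops)
  next
    case False
    \<comment> \<open>Outside \<open>C\<close> the word vanishes because it has a factor that does;
      this needs l >= 1, as the empty word is 1.\<close>
    obtain x ys where x: "xs = x # ys" using l by (cases xs) auto
    then obtain i where i: "i \<in> I" "x = restrict_family C (\<lambda>r. f r i)" using xs by auto
    then show ?thesis using at[OF i(1)] False x by (simp add: mat_at_ops)
  qed
qed

section \<open>Finiteness for generalized representations of order l\<close>

context jordan
begin

text \<open>The triangular argument needs finite generating sets, so it is run on the images of unit
  vectors; linearity then extends stability to all of U_{-1} and all A_x.\<close>

lemma finite_dimensional_graded:
  fixes C :: "(nat \<times> 's) set" and rm :: "nat \<times> 's \<Rightarrow> cv \<Rightarrow> cm"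
    and r1 :: "nat \<times> 's \<Rightarrow> jprod \<Rightarrow> cm"
  defines "P \<equiv> \<lambda>x. restrict_family C (\<lambda>r. rm r x)"
    and "Q \<equiv> \<lambda>x. restrict_family C (\<lambda>r. r1 r (Aa m jm x))"
  assumes l: "l \<ge> 1" and gr: "\<And>r. r \<in> C \<Longrightarrow> l_graded m jm (fst r) l (rm r) (r0 r) (r1 r)"
  shows "\<exists>U B. fam.subspace U \<and> finite B \<and> U \<subseteq> fam.span B \<and> 1 \<in> U \<and>
    left_ideal (P ` V \<union> Q ` V) U"
proof -
  define D where "D x = restrict_family C (\<lambda>r. r0 r (Lmat m jm x))" for x
  have lie: "lie_rep m jm (fst r) (rm r) (r0 r) (r1 r)" if "r \<in> C" for r
    using gr[OF that] by (simp add: l_graded_def)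
  have linP: "lin_map m (fst r) (rm r)" if "r \<in> C" for r
    using lie[OF that] by (simp add: lie_rep_def)
  have linQ: "lin_map m (fst r) (\<lambda>x. r1 r (Aa m jm x))" if "r \<in> C" for r
    by (rule lie_rep_Aa_linear[OF lie[OF that]])
  have cP: "rm r x \<in> carrier_mat (fst r) (fst r)" if "x \<in> V" "r \<in> C" for r x
    using linP[OF that(2)] that(1) by (simp add: lin_map_def)
  have cQ: "r1 r (Aa m jm x) \<in> carrier_mat (fst r) (fst r)" if "x \<in> V" "r \<in> C" for r x
    using linQ[OF that(2)] that(1) by (simp add: lin_map_def)
  have cD: "r0 r (Lmat m jm x) \<in> carrier_mat (fst r) (fst r)" if "x \<in> V" "r \<in> C" for r x
    by (rule lie_rep_Lmat_carrier[OF lie[OF that(2)] that(1)])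
  have DP: "D x * P y - P y * D x = P (jm x y)" if "x \<in> V" "y \<in> V" for x y
  proof -
    have "D x * P y - P y * D x = restrict_family C (\<lambda>r. comm (r0 r (Lmat m jm x)) (rm r y))"
      unfolding D_def P_def using cD cP that by (intro restrict_family_comm) auto
    also have "\<dots> = P (jm x y)" unfolding P_def
      by (intro restrict_family_cong lie_rep_comm_Lmat(1)[OF lie that])
    finally show ?thesis .
  qed
  have DQ: "D x * Q y - Q y * D x = - Q (jm x y)" if "x \<in> V" "y \<in> V" for x y
  proof -
    have "D x * Q y - Q y * D x = restrict_family C (\<lambda>r. comm (r0 r (Lmat m jm x)) (r1 r (Aa m jm y)))"
      unfolding D_def Q_def using cD cQ that by (intro restrict_family_comm) auto
    also have "\<dots> = restrict_family C (\<lambda>r. - r1 r (Aa m jm (jm x y)))"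
      by (intro restrict_family_cong lie_rep_comm_Lmat(2)[OF lie that])
    also have "\<dots> = - Q (jm x y)"
      unfolding Q_def using cQ that by (intro restrict_family_uminus[symmetric]) auto
    finally show ?thesis .
  qed
  have QP: "Q x * P y - P y * Q x = D (jm x y) + (D y * D x - D x * D y)" if "x \<in> V" "y \<in> V" for x y
  proof -
    have "Q x * P y - P y * Q x = restrict_family C (\<lambda>r. comm (r1 r (Aa m jm x)) (rm r y))"
      unfolding Q_def P_def using cQ cP that by (intro restrict_family_comm) auto
    also have "\<dots> = restrict_family C
       (\<lambda>r. r0 r (Lmat m jm (jm x y)) + comm (r0 r (Lmat m jm y)) (r0 r (Lmat m jm x)))"
      by (intro restrict_family_cong lie_rep_comm_Aa[OF lie that])
    also have "\<dots> = D (jm x y) + restrict_family C (\<lambda>r. comm (r0 r (Lmat m jm y)) (r0 r (Lmat m jm x)))"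
      unfolding D_def using cD that by (intro restrict_family_add[symmetric] comm_carrier) auto
    also have "restrict_family C (\<lambda>r. comm (r0 r (Lmat m jm y)) (r0 r (Lmat m jm x))) = D y * D x - D x * D y"
      unfolding D_def using cD that by (intro restrict_family_comm[symmetric]) auto
    finally show ?thesis .
  qed
  let ?P = "(\<lambda>j. P (unit_vec m j)) ` {..<m}" and ?Q = "(\<lambda>j. Q (unit_vec m j)) ` {..<m}"
  let ?T = "{q * p - p * q | q p. q \<in> ?Q \<and> p \<in> ?P}"
  have spanP: "P x \<in> fam.span ?P" if "x \<in> V" for x
    unfolding P_def using restrict_family_in_span[of C m rm, OF linP that] .
  have spanQ: "Q x \<in> fam.span ?Q" if "x \<in> V" for x
    unfolding Q_def using restrict_family_in_span[of C m "\<lambda>r x. r1 r (Aa m jm x)", OF linQ that] .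
  \<comment> \<open>Bracketing with d + [a, b] reduces to iterated brackets with a, b and d, which
    \<open>DP\<close> and \<open>DQ\<close> evaluate when these are images of some L_x.\<close>
  have jacobi: "(d + (a * b - b * a)) * z - z * (d + (a * b - b * a))
    = (d * z - z * d) + ((a * (b * z - z * b) - (b * z - z * b) * a) - (b * (a * z - z * a) - (a * z - z * a) * b))"
    for a b d z :: "'s mat_family" by (simp add: algebra_simps)
  have T: "\<exists>x\<in>V. \<exists>y\<in>V. t = D (jm x y) + (D y * D x - D x * D y)" if "t \<in> ?T" for t
  proof -
    from that obtain i j where "t = Q (unit_vec m i) * P (unit_vec m j) - P (unit_vec m j) * Q (unit_vec m i)"
      by blast
    then show ?thesis using QP[of "unit_vec m i" "unit_vec m j"] unit_vec_carrier by metis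
  qed
  interpret three_graded_generation fam_scale ?P ?Q ?T
  proof
    fix t p assume t: "t \<in> ?T" and "p \<in> ?P"
    then obtain z where z: "z \<in> V" "p = P z" using unit_vec_carrier by blast
    obtain x y where xy: "x \<in> V" "y \<in> V" "t = D (jm x y) + (D y * D x - D x * D y)" using T[OF t] by blast
    have "t * p - p * t = P (jm (jm x y) z) + (P (jm y (jm x z)) - P (jm x (jm y z)))"
      unfolding xy(3) z(2) jacobi using xy z(1) by (simp add: DP)
    then show "t * p - p * t \<in> fam.span ?P"
      using xy z by (simp add: fam.span_add fam.span_diff spanP)
  next
    fix t q assume t: "t \<in> ?T" and "q \<in> ?Q"
    then obtain z where z: "z \<in> V" "q = Q z" using unit_vec_carrier by blast
    obtain x y where xy: "x \<in> V" "y \<in> V" "t = D (jm x y) + (D y * D x - D x * D y)" using T[OF t] by blast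
    \<comment> \<open>For the second of two nested brackets, where the sign from \<open>DQ\<close>
      flips back.\<close>
    have DDQ: "D a * (- Q b) - (- Q b) * D a = Q (jm a b)" if "a \<in> V" "b \<in> V" for a b
      using DQ[OF that] by (simp add: algebra_simps)
    have "t * q - q * t = - Q (jm (jm x y) z) + (Q (jm y (jm x z)) - Q (jm x (jm y z)))"
      unfolding xy(3) z(2) jacobi using xy z(1) by (simp add: DQ DDQ del: mult_minus_right mult_minus_left)
    then show "t * q - q * t \<in> fam.span ?Q"
      using xy z by (simp add: fam.span_add fam.span_diff fam.span_neg spanQ del: minus_diff_eq)
  qed (rule refl)
  obtain Vs where Vs: "\<And>r. r \<in> C \<Longrightarrow> graded_decomp (fst r) l (Vs r)"
    "\<And>r j v x. r \<in> C \<Longrightarrow> j \<in> {1..l} \<Longrightarrow> v \<in> Vs r j \<Longrightarrow> x \<in> V \<Longrightarrow>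
       rm r x *\<^sub>v v \<in> Vz (fst r) l (Vs r) (int j + (-1))"
    "\<And>r j v x. r \<in> C \<Longrightarrow> j \<in> {1..l} \<Longrightarrow> v \<in> Vs r j \<Longrightarrow> x \<in> V \<Longrightarrow>
       r1 r (Aa m jm x) *\<^sub>v v \<in> Vz (fst r) l (Vs r) (int j + 1)"
  proof -
    have "\<forall>r\<in>C. \<exists>W. graded_decomp (fst r) l W \<and> (\<forall>j\<in>{1..l}. \<forall>v\<in>W j. \<forall>x\<in>V.
        rm r x *\<^sub>v v \<in> Vz (fst r) l W (int j + (-1)) \<and> r1 r (Aa m jm x) *\<^sub>v v \<in> Vz (fst r) l W (int j + 1))"
    proof
      fix r assume "r \<in> C"
      from gr[OF this] show "\<exists>W. graded_decomp (fst r) l W \<and> (\<forall>j\<in>{1..l}. \<forall>v\<in>W j. \<forall>x\<in>V.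
        rm r x *\<^sub>v v \<in> Vz (fst r) l W (int j + (-1)) \<and> r1 r (Aa m jm x) *\<^sub>v v \<in> Vz (fst r) l W (int j + 1))"
        unfolding l_graded_def using U1_Aa[of _ m jm] by (elim conjE exE) (rule exI, auto)
    qed
    from bchoice[OF this] show ?thesis using that by blast
  qed
  have nilP: "prod_list ps = 0" if "set ps \<subseteq> ?P" "length ps = l" for ps
  proof (rule graded_family_word_zero[where s = "-1" and f = rm and I = V, OF Vs(1) _ cP Vs(2)])
    show "set ps \<subseteq> (\<lambda>i. restrict_family C (\<lambda>r. rm r i)) ` V"
      using that(1) unfolding P_def by auto
  qed (use that l in auto)
  have nilQ: "prod_list qs = 0" if "set qs \<subseteq> ?Q" "length qs = l" for qs
  proof (rule graded_family_word_zero[where s = 1 and f = "\<lambda>r x. r1 r (Aa m jm x)" and I = V, OF Vs(1) _ cQ Vs(3)])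
    show "set qs \<subseteq> (\<lambda>i. restrict_family C (\<lambda>r. r1 r (Aa m jm i))) ` V"
      using that(1) unfolding Q_def by auto
  qed (use that l in auto)
  have "\<exists>U B. fam.subspace U \<and> finite B \<and> U \<subseteq> fam.span B \<and> 1 \<in> U \<and> (\<forall>x\<in>?P \<union> ?Q. \<forall>u\<in>U. x * u \<in> U)"
    by (rule finite_dimensional_left_ideal[OF l _ _ nilP nilQ]) simp_all
  then obtain U B where UB: "fam.subspace U" "finite B" "U \<subseteq> fam.span B" "1 \<in> U"
    "\<And>x u. x \<in> ?P \<union> ?Q \<Longrightarrow> u \<in> U \<Longrightarrow> x * u \<in> U" by blast
  have sub: "P ` V \<union> Q ` V \<subseteq> fam.span (?P \<union> ?Q)"
    using spanP spanQ fam.span_mono[of ?P "?P \<union> ?Q"] fam.span_mono[of ?Q "?P \<union> ?Q"] by blast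
  have "left_ideal (P ` V \<union> Q ` V) U"
    by (rule left_ideal_mono[OF left_ideal_span[OF UB(1,5)] sub])
  then show ?thesis using UB(1-4) by blast
qed

text \<open>For each triple (n, \<pi>, a) one graded representation of L(A) is chosen, but the index
  remains the triple: irreducibility and equivalence refer to \<pi> and a only. They are tested on
  \<open>P x\<close> and \<open>- Q e\<close>, under which the left ideal is stable.\<close>

lemma finitely_many_generalized_reps:
  assumes l: "l \<ge> 1" and e: "jordan_unit m jm e"
  shows "fin_up_to
     (\<lambda>(n, \<pi>, a). genrep_order m jm e n l \<pi> a \<and> irreducible_fam n (insert a (\<pi> ` V)))
     (\<lambda>(n, \<pi>, a) (n', \<pi>', a'). gen_equiv m n \<pi> a n' \<pi>' a')"
proof -
  let ?C = "{(n, \<pi>, a). genrep_order m jm e n l \<pi> a \<and> irreducible_fam n (insert a (\<pi> ` V))}"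
  have eV: "e \<in> V" using e by (simp add: jordan_unit_def)
  have "\<forall>r\<in>?C. \<exists>\<rho>. l_graded m jm (fst r) l (fst \<rho>) (fst (snd \<rho>)) (snd (snd \<rho>)) \<and>
      (\<forall>x\<in>V. fst (snd r) x = fst \<rho> x) \<and> snd (snd r) = - snd (snd \<rho>) (Aa m jm e)"
    (is "\<forall>r\<in>?C. \<exists>\<rho>. ?R r \<rho>")
  proof
    fix r assume "r \<in> ?C"
    then obtain rm r0 r1 where "l_graded m jm (fst r) l rm r0 r1" "\<forall>x\<in>V. fst (snd r) x = rm x"
      "snd (snd r) = - r1 (Aa m jm e)"
      unfolding Aa_unit[OF e] by (cases r) (auto simp: genrep_order_def)
    then show "\<exists>\<rho>. ?R r \<rho>" by (intro exI[of _ "(rm, r0, r1)"]) simp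
  qed
  from bchoice[OF this] obtain \<rho> where \<rho>_all: "\<forall>r\<in>?C. ?R r (\<rho> r)" by blast
  have "\<And>r. r \<in> ?C \<Longrightarrow> l_graded m jm (fst r) l (fst (\<rho> r)) (fst (snd (\<rho> r))) (snd (snd (\<rho> r)))"
    "\<And>r x. r \<in> ?C \<Longrightarrow> x \<in> V \<Longrightarrow> fst (snd r) x = fst (\<rho> r) x"
    "\<And>r. r \<in> ?C \<Longrightarrow> snd (snd r) = - snd (snd (\<rho> r)) (Aa m jm e)"
    using \<rho>_all by blast+
  note \<rho> = this
  define P where "P x = restrict_family ?C (\<lambda>r. fst (\<rho> r) x)" for x
  define Q where "Q x = restrict_family ?C (\<lambda>r. snd (snd (\<rho> r)) (Aa m jm x))" for x
  have lie: "lie_rep m jm (fst r) (fst (\<rho> r)) (fst (snd (\<rho> r))) (snd (snd (\<rho> r)))" if "r \<in> ?C" for r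
    using \<rho>(1)[OF that] by (simp add: l_graded_def)
  have atP: "mat_at (P x) r = fst (snd r) x" if "x \<in> V" "r \<in> ?C" for x r
  proof -
    have "fst (\<rho> r) x \<in> carrier_mat (fst r) (fst r)" if "r \<in> ?C" for r
      using lie[OF that] \<open>x \<in> V\<close> by (simp add: lie_rep_def lin_map_def)
    then show ?thesis unfolding P_def using \<rho>(2)[OF that(2,1)] that by (subst mat_at_restrict) auto
  qed
  have atQ: "mat_at (- Q e) r = snd (snd r)" if "r \<in> ?C" for r
  proof -
    have "snd (snd (\<rho> r)) (Aa m jm e) \<in> carrier_mat (fst r) (fst r)" if "r \<in> ?C" for r
      using lie_rep_Aa_linear[OF lie[OF that]] eV by (simp add: lin_map_def)
    then show ?thesis unfolding Q_def mat_at_ops using \<rho>(3)[OF that] that by (subst mat_at_restrict) auto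
  qed
  obtain U B where UB: "fam.subspace U" "finite B" "U \<subseteq> fam.span B" "1 \<in> U" "left_ideal (P ` V \<union> Q ` V) U"
    using finite_dimensional_graded[OF l \<rho>(1)] unfolding P_def Q_def by blast
  let ?X = "insert (- Q e) (P ` V)"
  have "left_ideal ?X U"
    unfolding left_ideal_def
  proof (intro conjI ballI UB(1))
    fix x u assume x: "x \<in> ?X" and u: "u \<in> U"
    have xu: "y * u \<in> U" if "y \<in> P ` V \<union> Q ` V" for y
      using UB(5) that u by (simp only: left_ideal_def)
    show "x * u \<in> U"
    proof (cases "x \<in> P ` V")
      case True then show ?thesis by (intro xu UnI1)
    next
      case False
      then have "x = - Q e" using x by simp
      moreover have "Q e * u \<in> U" using eV by (intro xu UnI2 imageI)
      ultimately show ?thesis using fam.subspace_neg[OF UB(1)] by simp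
    qed
  qed
  then have "\<exists>S\<subseteq>?C. finite S \<and> (\<forall>r\<in>?C. \<exists>s\<in>S. intertwined ?X r s)"
  proof (rule finitely_many_irreducibles[OF _ UB(4,2,3)])
    fix r assume r: "r \<in> ?C"
    have "(\<lambda>x. mat_at x r) ` ?X = insert (snd (snd r)) (fst (snd r) ` V)"
      unfolding image_insert image_image atQ[OF r] using atP[OF _ r] by (intro arg_cong2[of _ _ _ _ insert] image_cong refl)
    then show "irreducible_fam (fst r) ((\<lambda>x. mat_at x r) ` ?X)" using r by auto
  qed
  then obtain S where S: "S \<subseteq> ?C" "finite S" "\<And>r. r \<in> ?C \<Longrightarrow> \<exists>s\<in>S. intertwined ?X r s" by blast
  have "\<exists>s\<in>S. case s of (n', \<pi>', a') \<Rightarrow> gen_equiv m n \<pi> a n' \<pi>' a'"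
    if r: "(n, \<pi>, a) \<in> ?C" for n \<pi> a
  proof -
    obtain s where s: "s \<in> S" "intertwined ?X (n, \<pi>, a) s" using S(3)[OF r] by blast
    then have sC: "s \<in> ?C" using S(1) by blast
    obtain F where F: "n = fst s" "F \<in> carrier_mat n n" "invertible_mat F"
      "\<And>x. x \<in> ?X \<Longrightarrow> F * mat_at x (n, \<pi>, a) = mat_at x s * F"
      using s(2) unfolding intertwined_def by auto
    have "F * \<pi> x = fst (snd s) x * F" if x: "x \<in> V" for x
      using F(4)[of "P x"] atP[OF x r] atP[OF x sC] x by simp
    moreover have "F * a = snd (snd s) * F"
      using F(4)[of "- Q e"] atQ[OF r] atQ[OF sC] by simp
    ultimately have "gen_equiv m n \<pi> a (fst s) (fst (snd s)) (snd (snd s))"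
      using F(1-3) unfolding gen_equiv_def by blast
    then show ?thesis using s(1) by (auto simp: case_prod_beta)
  qed
  then show ?thesis unfolding fin_up_to_def using S(2) by (intro exI[of _ S]) auto
qed

end

theorem theorem7:
  fixes m :: nat and jm :: jprod and e :: cv and l :: nat
  assumes "jordan_algebra m jm" and "simple_alg m jm" and "jordan_unit m jm e"
    and "l \<ge> 1"
  shows "fin_up_to
           (\<lambda>(n, \<pi>, a). genrep_order m jm e n l \<pi> a \<and>
                        irreducible_fam n (insert a (\<pi> ` carrier_vec m)))
           (\<lambda>(n, \<pi>, a) (n', \<pi>', a'). gen_equiv m n \<pi> a n' \<pi>' a')
       \<and> fin_up_to
           (\<lambda>(n, \<phi>). usual_rep m jm n \<phi> \<and> irreducible_fam n (\<phi> ` carrier_vec m))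
           (\<lambda>(n, \<phi>) (n', \<phi>'). rep_equiv m n \<phi> n' \<phi>')
       \<and> fin_up_to
           (\<lambda>(n, \<phi>). jacobson_rep m jm n \<phi> \<and> irreducible_fam n (\<phi> ` carrier_vec m))
           (\<lambda>(n, \<phi>) (n', \<phi>'). rep_equiv m n \<phi> n' \<phi>')"
proof -
  interpret jordan m jm by unfold_locales (rule assms(1))
  have "bilinear_on m jm" using assms(1) by (simp add: jordan_algebra_def)
  then show ?thesis
    using finitely_many_generalized_reps[OF assms(4,3)] finitely_many_usual_reps[of m jm]
      finitely_many_jacobson_reps[of m jm, OF _ jm_comm] by blast
qed

end
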